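(* Let $(\xi,X)$ and $(\eta,Y)$ be linear sections forming a grid on a double vector bundle $(D;A,B;M)$ with core $C$, where $X\in\Gamma A$, $\xi\in\Gamma_BD$, $Y\in\Gamma B$, $\eta\in\Gamma_AD$. Let $\mathsf w(\xi,\eta)\in\Gamma C$ be the warp of the grid, let $\ell_{\mathsf w(\xi,\eta)}\in C^\infty(C^* )$ be the corresponding linear function, and let $\xi^{\sqcap}$, $\eta^{\sqcap}$ and $[\![\xi^{\sqcap},\eta^{\sqcap}]\!]\in C^\infty(C^* )$ be as defined in the context. Then $$[\![\xi^{\sqcap},\eta^{\sqcap}]\!]=\ell_{\mathsf w(\xi,\eta)} .$$
   Context: All manifolds and maps are smooth. **Double vector bundles, grids, warps.** A double vector bundle $(D;A,B;M)$ is a square of vector bundles $D\to A$, $D\to B$, $A\to M$, $B\to M$ (with $D\to A\to M$ equal to $D\to B\to M$) such that the two structures on $D$ commute in the categorical sense (the structure maps of each vector bundle structure on $D$ are vector bundle morphisms with respect to the other; in particular $(d_1+_A d_2)+_B(d_3+_A d_4)=(d_1+_B d_3)+_A(d_2+_B d_4)$ whenever defined, and analogously for scalar multiplication), and such that $D\to A\times_M B$ is a surjective submersion. $+_A,-_A$ denote the operations of $D\to A$; $+_B,-_B$ those of $D\to B$; $\tilde 0_a$, $\tilde 0_b$ are the zeros of $D$ over $a\in A$, $b\in B$. The core $C$ is the set of elements of $D$ projecting to zero in both $A$ and $B$; the two structures coincide on it and make $C\to M$ a vector bundle. An element $d\in D$ projecting to $a\in A$, $b\in B$, $m\in M$ has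 outline $(d;a,b;m)$; the same notation is used for other double vector bundles. $\Gamma_BD$ denotes the sections of $D\to B$, and $\Gamma_AD$ those of $D\to A$. A linear section $(\xi,X)$ consists of $X\in\Gamma A$ and $\xi\in\Gamma_BD$ such that $\xi$ is a vector bundle morphism from $B\to M$ to $D\to A$ over $X$; a linear section $(\eta,Y)$ consists of $Y\in\Gamma B$ and $\eta\in\Gamma_AD$ with $\eta$ a vector bundle morphism from $A\to M$ to $D\to B$ over $Y$. A grid is a pair of such linear sections $(\xi,X)$, $(\eta,Y)$. Its warp $\mathsf w(\xi,\eta)\in\Gamma C$ is the unique section with, for all $m\in M$, $$\xi(Y(m))-_A\eta(X(m))=\mathsf w(\xi,\eta)(m)+_B\tilde 0_{X(m)},\qquad \xi(Y(m))-_B\eta(X(m))=\mathsf w(\xi,\eta)(m)+_A\tilde 0_{Y(m)} .$$ For $w\in\Gamma C$, $\ell_w\in C^\infty(C^* )$ is $\ell_w(\kappa)=\langle\kappa,w(m)\rangle$ for $\kappa\in C^*_m$. **Duals.** Let $D^{*A}\to A$ be the dual of the vector bundle $D\to A$, with pairing $\langle\ ,\ \rangle_A$ and projection $\gamma^A_A$. It is also a vector bundle over $C^*$, and $(D^{*A};A,C^*;M)$ is a double vector bundle with core $B^*$: for $\Phi\in D^{*A}$ over $a\in A_m$, the projection $\gamma^A_{C^*}(\Phi)\in C^*_m$ is $\langle\gamma^A_{C^*}(\Phi),c\rangle=\langle\Phi,\tilde 0_a+_Bc\rangle_A$ for $c\in C_m$; if $\Phi,\Phi'$ lie over the same $\kappa\in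 C^*$ and over $a,a'\in A$, then $\Phi+_{C^*}\Phi'$ lies over $a+a'$ and $\langle\Phi+_{C^*}\Phi',d+_Bd'\rangle_A=\langle\Phi,d\rangle_A+\langle\Phi',d'\rangle_A$ for $d,d'\in D$ over $a,a'$ with the same projection to $B$; scalar multiplication over $C^*$ is analogous. Exchanging the roles of $A$ and $B$ gives the double vector bundle $(D^{*B};C^*,B;M)$ with core $A^*$, pairing $\langle\ ,\ \rangle_B$ between $D^{*B}$ and $D$ over $B$, and projections $\gamma^B_B,\gamma^B_{C^*}$. There is a nondegenerate pairing of $D^{*A}$ and $D^{*B}$ over $C^*$: for $\Phi\in D^{*A}$ and $\Psi\in D^{*B}$ with outlines $(\Phi;a,\kappa;m)$, $(\Psi;\kappa,b;m)$, and any $d\in D$ with outline $(d;a,b;m)$, $$\|\Phi,\Psi\|_{C^*}=\langle\Phi,d\rangle_A-\langle\Psi,d\rangle_B ,$$ independently of $d$. Let $(D^{*A})^{*C^*}$ and $(D^{*B})^{*C^*}$ denote the duals of $D^{*A}\to C^*$ and $D^{*B}\to C^*$, with pairings written $\langle\ ,\ \rangle_{C^*}$. Let $Z_A:D^{*A}\to(D^{*B})^{*C^*}$ be the isomorphism defined by $\langle Z_A(\Phi),\Psi\rangle_{C^*}=\|\Phi,\Psi\|_{C^*}$. **The sections $\eta^{\sqcap}$, $\xi^{\sqcap}$ and their pairing.** Given a linear section $(\eta,Y)$ with $\eta\in\Gamma_AD$, the function $\Phi\mapsto\langle\Phi,\eta(\gamma^A_A(\Phi))\rangle_A$ on $D^{*A}$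 is linear over $C^*$ as well as over $A$, and $\eta^{\sqcap}\in\Gamma_{C^*}\bigl((D^{*A})^{*C^*}\bigr)$ is defined by $$\langle\eta^{\sqcap}(\kappa),\Phi\rangle_{C^*}=\langle\Phi,\eta(\gamma^A_A(\Phi))\rangle_A,\qquad \kappa\in C^*,\ \Phi\in D^{*A}\text{ over }\kappa .$$ Similarly, given $(\xi,X)$ with $\xi\in\Gamma_BD$, $\xi^{\sqcap}\in\Gamma_{C^*}\bigl((D^{*B})^{*C^*}\bigr)$ is defined by $\langle\xi^{\sqcap}(\kappa),\Psi\rangle_{C^*}=\langle\Psi,\xi(\gamma^B_B(\Psi))\rangle_B$ for $\Psi\in D^{*B}$ over $\kappa$. Finally $[\![\xi^{\sqcap},\eta^{\sqcap}]\!]\in C^\infty(C^* )$ is defined by $$[\![\xi^{\sqcap},\eta^{\sqcap}]\!](\kappa)=\bigl\langle\eta^{\sqcap}(\kappa),Z_A^{-1}(\xi^{\sqcap}(\kappa))\bigr\rangle_{C^*},\qquad\kappa\in C^* .$$ *)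

theory Defs
  imports "HOL-Analysis.Analysis"
begin

section \<open>Smooth manifolds and smooth maps\<close>

primrec C_on :: "nat \<Rightarrow> 'e::euclidean_space set \<Rightarrow> ('e \<Rightarrow> 'f::euclidean_space) \<Rightarrow> bool" where
  "C_on 0 S f \<longleftrightarrow> continuous_on S f"
| "C_on (Suc k) S f \<longleftrightarrow>
     (\<forall>x\<in>S. f differentiable at x) \<and> (\<forall>v. C_on k S (\<lambda>x. frechet_derivative f (at x) v))"

text \<open>
  Smoothness on an arbitrary subset of a Euclidean space is local extendability to a smooth map on
  an open set. It is applied to relatively open subsets of linear subspaces, where it agrees with
  smoothness in linear coordinates of the subspace.
\<close>

definition smooth_on :: "'e::euclidean_space set \<Rightarrow> ('e \<Rightarrow> 'f::euclidean_space) \<Rightarrow> bool" where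
  "smooth_on S f \<longleftrightarrow>
     (\<forall>x\<in>S. \<exists>U g. open U \<and> x \<in> U \<and> (\<forall>k. C_on k U g) \<and> (\<forall>y\<in>S \<inter> U. g y = f y))"

text \<open>
  A manifold is modelled on a linear subspace \<open>model\<close> of a Euclidean space, rather than on the whole
  space, because the class \<open>euclidean_space\<close> has no zero-dimensional member: the subspaces supply
  every dimension, including \<open>0\<close>. The atlas need not be maximal.
\<close>

record ('p, 'e) manifold =
  space_of :: "'p topology"
  model :: "'e set"
  atlas :: "('p set \<times> ('p \<Rightarrow> 'e)) set"

definition is_chart :: "('p, 'e::euclidean_space) manifold \<Rightarrow> 'p set \<Rightarrow> ('p \<Rightarrow> 'e) \<Rightarrow> bool" where
  "is_chart X U \<phi> \<longleftrightarrow>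
     openin (space_of X) U \<and> openin (top_of_set (model X)) (\<phi> ` U) \<and>
     homeomorphic_map (subtopology (space_of X) U) (top_of_set (\<phi> ` U)) \<phi>"

definition smooth_manifold :: "('p, 'e::euclidean_space) manifold \<Rightarrow> bool" where
  "smooth_manifold X \<longleftrightarrow>
     Hausdorff_space (space_of X) \<and> second_countable (space_of X) \<and> subspace (model X) \<and>
     (\<forall>(U, \<phi>)\<in>atlas X. is_chart X U \<phi>) \<and>
     (\<Union>(U, \<phi>)\<in>atlas X. U) = topspace (space_of X) \<and>
     (\<forall>(U, \<phi>)\<in>atlas X. \<forall>(V, \<psi>)\<in>atlas X. smooth_on (\<phi> ` (U \<inter> V)) (\<psi> \<circ> inv_into U \<phi>))"

definition smooth_map ::
  "('p, 'e::euclidean_space) manifold \<Rightarrow> ('q, 'f::euclidean_space) manifold \<Rightarrow> ('p \<Rightarrow> 'q) \<Rightarrow> bool"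
  where
  "smooth_map X Y f \<longleftrightarrow>
     continuous_map (space_of X) (space_of Y) f \<and>
     (\<forall>(U, \<phi>)\<in>atlas X. \<forall>(V, \<psi>)\<in>atlas Y.
        smooth_on (\<phi> ` {p \<in> U. f p \<in> V}) (\<psi> \<circ> f \<circ> inv_into U \<phi>))"

definition diffeomorphism ::
  "('p, 'e::euclidean_space) manifold \<Rightarrow> ('q, 'f::euclidean_space) manifold \<Rightarrow> ('p \<Rightarrow> 'q) \<Rightarrow> bool"
  where
  "diffeomorphism X Y f \<longleftrightarrow>
     bij_betw f (topspace (space_of X)) (topspace (space_of Y)) \<and>
     smooth_map X Y f \<and> smooth_map Y X (inv_into (topspace (space_of X)) f)"

definition open_submanifold :: "('p, 'e) manifold \<Rightarrow> 'p set \<Rightarrow> ('p, 'e) manifold" where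
  "open_submanifold X W =
     \<lparr>space_of = subtopology (space_of X) W, model = model X,
      atlas = {(U \<inter> W, \<phi>) |U \<phi>. (U, \<phi>) \<in> atlas X}\<rparr>"

definition product_manifold ::
  "('p, 'e) manifold \<Rightarrow> ('q, 'f) manifold \<Rightarrow> ('p \<times> 'q, 'e \<times> 'f) manifold" where
  "product_manifold X Y =
     \<lparr>space_of = prod_topology (space_of X) (space_of Y), model = model X \<times> model Y,
      atlas = {(U \<times> V, map_prod \<phi> \<psi>) |U \<phi> V \<psi>. (U, \<phi>) \<in> atlas X \<and> (V, \<psi>) \<in> atlas Y}\<rparr>"

definition subspace_manifold :: "'e::euclidean_space set \<Rightarrow> ('e, 'e) manifold" where
  "subspace_manifold F = \<lparr>space_of = top_of_set F, model = F, atlas = {(F, \<lambda>v. v)}\<rparr>"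

text \<open>
  The tangent map of \<open>f\<close> at \<open>p\<close>, expressed in a chart \<open>(U, \<phi>)\<close> at \<open>p\<close> and a chart \<open>(V, \<psi>)\<close> at \<open>f p\<close>.
  The derivative within \<open>\<phi> ` U\<close> is determined only on \<open>model X\<close>, and it is to be applied only there.
\<close>

definition tangent_map ::
  "('p \<Rightarrow> 'q) \<Rightarrow> 'p \<Rightarrow> 'p set \<times> ('p \<Rightarrow> 'e::euclidean_space) \<Rightarrow>
   'q set \<times> ('q \<Rightarrow> 'f::euclidean_space) \<Rightarrow> 'e \<Rightarrow> 'f" where
  "tangent_map f p = (\<lambda>(U, \<phi>) (V, \<psi>).
     frechet_derivative (\<psi> \<circ> f \<circ> inv_into U \<phi>) (at (\<phi> p) within \<phi> ` U))"

definition charts_at :: "('p, 'e) manifold \<Rightarrow> 'p \<Rightarrow> ('p set \<times> ('p \<Rightarrow> 'e)) set" where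
  "charts_at X p = {(U, \<phi>) \<in> atlas X. p \<in> U}"


section \<open>Families of vector spaces and vector bundles\<close>

record ('t, 'x) family =
  tot :: "'t set"
  bas :: "'x set"
  prj :: "'t \<Rightarrow> 'x"
  add :: "'t \<Rightarrow> 't \<Rightarrow> 't"
  smult :: "real \<Rightarrow> 't \<Rightarrow> 't"

definition fibre :: "('t, 'x) family \<Rightarrow> 'x \<Rightarrow> 't set" where
  "fibre V x = {v \<in> tot V. prj V v = x}"

definition zer :: "('t, 'x) family \<Rightarrow> 'x \<Rightarrow> 't" where
  "zer V x = (THE z. z \<in> fibre V x \<and> (\<forall>v\<in>fibre V x. add V z v = v))"

definition diff :: "('t, 'x) family \<Rightarrow> 't \<Rightarrow> 't \<Rightarrow> 't" where
  "diff V v w = add V v (smult V (-1) w)"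

definition vector_space_family :: "('t, 'x) family \<Rightarrow> bool" where
  "vector_space_family V \<longleftrightarrow>
     prj V ` tot V \<subseteq> bas V \<and>
     (\<forall>x\<in>bas V.
       (\<forall>u\<in>fibre V x. \<forall>v\<in>fibre V x. add V u v \<in> fibre V x \<and> add V u v = add V v u) \<and>
       (\<forall>u\<in>fibre V x. \<forall>v\<in>fibre V x. \<forall>w\<in>fibre V x. add V (add V u v) w = add V u (add V v w)) \<and>
       (\<exists>z\<in>fibre V x. \<forall>v\<in>fibre V x. add V z v = v \<and> (\<exists>w\<in>fibre V x. add V v w = z)) \<and>
       (\<forall>r. \<forall>v\<in>fibre V x. smult V r v \<in> fibre V x) \<and>
       (\<forall>r. \<forall>u\<in>fibre V x. \<forall>v\<in>fibre V x. smult V r (add V u v) = add V (smult V r u) (smult V r v)) \<and>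
       (\<forall>r s. \<forall>v\<in>fibre V x. smult V (r + s) v = add V (smult V r v) (smult V s v)) \<and>
       (\<forall>r s. \<forall>v\<in>fibre V x. smult V (r * s) v = smult V r (smult V s v)) \<and>
       (\<forall>v\<in>fibre V x. smult V 1 v = v))"

text \<open>
  The typical fibre \<open>F\<close> is taken inside the Euclidean space on which the total space \<open>E\<close> is modelled;
  this is no restriction, since the rank is at most the dimension of \<open>E\<close>. Smoothness of the
  projection, the zero section and the operations follows from local triviality.
\<close>

definition vector_bundle ::
  "('t, 'e::euclidean_space) manifold \<Rightarrow> ('x, 'f::euclidean_space) manifold \<Rightarrow>
   ('t, 'x) family \<Rightarrow> bool" where
  "vector_bundle E X V \<longleftrightarrow>
     smooth_manifold E \<and> smooth_manifold X \<and> vector_space_family V \<and>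
     topspace (space_of E) = tot V \<and> topspace (space_of X) = bas V \<and>
     smooth_map E X (prj V) \<and>
     (\<exists>F::'e set. subspace F \<and>
       (\<forall>x\<in>bas V. \<exists>U t. openin (space_of X) U \<and> x \<in> U \<and>
          diffeomorphism (open_submanifold E {v \<in> tot V. prj V v \<in> U})
            (product_manifold (open_submanifold X U) (subspace_manifold F))
            (\<lambda>v. (prj V v, t v)) \<and>
          (\<forall>y\<in>U. \<forall>v\<in>fibre V y. \<forall>w\<in>fibre V y. t (add V v w) = t v + t w) \<and>
          (\<forall>y\<in>U. \<forall>v\<in>fibre V y. \<forall>r. t (smult V r v) = r *\<^sub>R t v)))"

definition smooth_section ::
  "('x, 'f::euclidean_space) manifold \<Rightarrow> ('t, 'e::euclidean_space) manifold \<Rightarrow>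
   ('t, 'x) family \<Rightarrow> ('x \<Rightarrow> 't) \<Rightarrow> bool" where
  "smooth_section X E V s \<longleftrightarrow> smooth_map X E s \<and> (\<forall>x\<in>bas V. prj V (s x) = x)"

text \<open>\<open>F\<close> maps fibres linearly to fibres, covering the base map \<open>f\<close>.\<close>

definition bundle_morphism ::
  "('t, 'x) family \<Rightarrow> ('u, 'y) family \<Rightarrow> ('t \<Rightarrow> 'u) \<Rightarrow> ('x \<Rightarrow> 'y) \<Rightarrow> bool" where
  "bundle_morphism V W F f \<longleftrightarrow>
     (\<forall>x\<in>bas V. f x \<in> bas W \<and>
        (\<forall>v\<in>fibre V x. F v \<in> fibre W (f x)) \<and>
        (\<forall>v\<in>fibre V x. \<forall>w\<in>fibre V x. F (add V v w) = add W (F v) (F w)) \<and>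
        (\<forall>r. \<forall>v\<in>fibre V x. F (smult V r v) = smult W r (F v)))"

text \<open>
  The dual of a family; a covector carries its base point and is extensional outside its fibre.
\<close>

definition dual :: "('t, 'x) family \<Rightarrow> ('x \<times> ('t \<Rightarrow> real), 'x) family" where
  "dual V =
     \<lparr>tot = {(x, \<phi>). x \<in> bas V \<and> \<phi> \<in> extensional (fibre V x) \<and>
               (\<forall>v\<in>fibre V x. \<forall>w\<in>fibre V x. \<phi> (add V v w) = \<phi> v + \<phi> w) \<and>
               (\<forall>r. \<forall>v\<in>fibre V x. \<phi> (smult V r v) = r * \<phi> v)},
      bas = bas V,
      prj = fst,
      add = (\<lambda>(x, \<phi>) (y, \<psi>). (x, \<lambda>v\<in>fibre V x. \<phi> v + \<psi> v)),
      smult = (\<lambda>r (x, \<phi>). (x, \<lambda>v\<in>fibre V x. r * \<phi> v))\<rparr>"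

definition pairing :: "'x \<times> ('t \<Rightarrow> real) \<Rightarrow> 't \<Rightarrow> real" where
  "pairing \<Phi> v = snd \<Phi> v"


section \<open>Double vector bundles\<close>

record ('d, 'a, 'b, 'm, 'ed, 'ea, 'eb, 'em) dvb =
  manD :: "('d, 'ed) manifold"
  manA :: "('a, 'ea) manifold"
  manB :: "('b, 'eb) manifold"
  manM :: "('m, 'em) manifold"
  DA :: "('d, 'a) family"
  DB :: "('d, 'b) family"
  AM :: "('a, 'm) family"
  BM :: "('b, 'm) family"

text \<open>For \<open>D \<rightarrow> A\<close>, \<open>D \<rightarrow> B\<close>, \<open>A \<rightarrow> M\<close>: the family \<open>D \<times>\<^sub>B D \<rightarrow> A \<times>\<^sub>M A\<close>, with the structure of \<open>D \<rightarrow> A\<close>.\<close>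

definition fibre_square ::
  "('d, 'a) family \<Rightarrow> ('d, 'b) family \<Rightarrow> ('a, 'm) family \<Rightarrow> ('d \<times> 'd, 'a \<times> 'a) family" where
  "fibre_square VA VB WA =
     \<lparr>tot = {(d, d'). d \<in> tot VA \<and> d' \<in> tot VA \<and> prj VB d = prj VB d'},
      bas = {(a, a'). a \<in> bas VA \<and> a' \<in> bas VA \<and> prj WA a = prj WA a'},
      prj = map_prod (prj VA) (prj VA),
      add = (\<lambda>(d, d') (e, e'). (add VA d e, add VA d' e')),
      smult = (\<lambda>r. map_prod (smult VA r) (smult VA r))\<rparr>"

text \<open>
  The structure maps of \<open>D \<rightarrow> B\<close> (projection, zero section, addition, scalar multiplication) are
  morphisms with respect to \<open>D \<rightarrow> A\<close> (and \<open>B \<rightarrow> M\<close>), over those of \<open>A \<rightarrow> M\<close>.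
\<close>

definition structure_maps_linear ::
  "('d, 'a) family \<Rightarrow> ('d, 'b) family \<Rightarrow> ('a, 'm) family \<Rightarrow> ('b, 'm) family \<Rightarrow> bool" where
  "structure_maps_linear VA VB WA WB \<longleftrightarrow>
     bundle_morphism VA WB (prj VB) (prj WA) \<and>
     bundle_morphism WB VA (zer VB) (zer WA) \<and>
     bundle_morphism (fibre_square VA VB WA) VA
       (\<lambda>(d, d'). add VB d d') (\<lambda>(a, a'). add WA a a') \<and>
     (\<forall>r. bundle_morphism VA VA (smult VB r) (smult WA r))"

text \<open>
  In the last clause, the tangent space of \<open>A \<times>\<^sub>M B\<close> at \<open>(a, b)\<close> is the set of pairs of tangent vectors
  at \<open>a\<close> and \<open>b\<close> with the same image in the tangent space of \<open>M\<close>.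
\<close>

definition surjective_submersion ::
  "('d, 'a, 'b, 'm, 'ed::euclidean_space, 'ea::euclidean_space,
    'eb::euclidean_space, 'em::euclidean_space) dvb \<Rightarrow> bool" where
  "surjective_submersion D \<longleftrightarrow>
     (\<forall>a\<in>tot (AM D). \<forall>b\<in>tot (BM D). prj (AM D) a = prj (BM D) b \<longrightarrow>
        (\<exists>d\<in>tot (DA D). prj (DA D) d = a \<and> prj (DB D) d = b)) \<and>
     (\<forall>d\<in>tot (DA D). \<forall>cd\<in>charts_at (manD D) d.
        \<forall>ca\<in>charts_at (manA D) (prj (DA D) d). \<forall>cb\<in>charts_at (manB D) (prj (DB D) d).
        \<forall>cm\<in>charts_at (manM D) (prj (AM D) (prj (DA D) d)).
        \<forall>u\<in>model (manA D). \<forall>v\<in>model (manB D).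
          tangent_map (prj (AM D)) (prj (DA D) d) ca cm u =
          tangent_map (prj (BM D)) (prj (DB D) d) cb cm v \<longrightarrow>
          (\<exists>w\<in>model (manD D). tangent_map (prj (DA D)) d cd ca w = u \<and>
                              tangent_map (prj (DB D)) d cd cb w = v))"

definition double_vector_bundle ::
  "('d, 'a, 'b, 'm, 'ed::euclidean_space, 'ea::euclidean_space,
    'eb::euclidean_space, 'em::euclidean_space) dvb \<Rightarrow> bool" where
  "double_vector_bundle D \<longleftrightarrow>
     vector_bundle (manD D) (manA D) (DA D) \<and> vector_bundle (manD D) (manB D) (DB D) \<and>
     vector_bundle (manA D) (manM D) (AM D) \<and> vector_bundle (manB D) (manM D) (BM D) \<and>
     (\<forall>d\<in>tot (DA D). prj (AM D) (prj (DA D) d) = prj (BM D) (prj (DB D) d)) \<and>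
     structure_maps_linear (DA D) (DB D) (AM D) (BM D) \<and>
     structure_maps_linear (DB D) (DA D) (BM D) (AM D) \<and>
     surjective_submersion D"

text \<open>The operations of \<open>D \<rightarrow> A\<close> and \<open>D \<rightarrow> B\<close> coincide on the core; those of \<open>D \<rightarrow> A\<close> are used here.\<close>

definition core ::
  "('d, 'a, 'b, 'm, 'ed, 'ea, 'eb, 'em) dvb \<Rightarrow> ('d, 'm) family" where
  "core D =
     \<lparr>tot = {d \<in> tot (DA D). \<exists>m\<in>bas (AM D).
               prj (DA D) d = zer (AM D) m \<and> prj (DB D) d = zer (BM D) m},
      bas = bas (AM D),
      prj = (\<lambda>d. prj (AM D) (prj (DA D) d)),
      add = add (DA D),
      smult = smult (DA D)\<rparr>"

definition linear_section_over_B ::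
  "('d, 'a, 'b, 'm, 'ed::euclidean_space, 'ea::euclidean_space,
    'eb::euclidean_space, 'em::euclidean_space) dvb \<Rightarrow> ('b \<Rightarrow> 'd) \<Rightarrow> ('m \<Rightarrow> 'a) \<Rightarrow> bool" where
  "linear_section_over_B D \<xi> X \<longleftrightarrow>
     smooth_section (manM D) (manA D) (AM D) X \<and> smooth_section (manB D) (manD D) (DB D) \<xi> \<and>
     bundle_morphism (BM D) (DA D) \<xi> X"

definition linear_section_over_A ::
  "('d, 'a, 'b, 'm, 'ed::euclidean_space, 'ea::euclidean_space,
    'eb::euclidean_space, 'em::euclidean_space) dvb \<Rightarrow> ('a \<Rightarrow> 'd) \<Rightarrow> ('m \<Rightarrow> 'b) \<Rightarrow> bool" where
  "linear_section_over_A D \<eta> Y \<longleftrightarrow>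
     smooth_section (manM D) (manB D) (BM D) Y \<and> smooth_section (manA D) (manD D) (DA D) \<eta> \<and>
     bundle_morphism (AM D) (DB D) \<eta> Y"

definition grid ::
  "('d, 'a, 'b, 'm, 'ed::euclidean_space, 'ea::euclidean_space,
    'eb::euclidean_space, 'em::euclidean_space) dvb \<Rightarrow>
   ('b \<Rightarrow> 'd) \<Rightarrow> ('m \<Rightarrow> 'a) \<Rightarrow> ('a \<Rightarrow> 'd) \<Rightarrow> ('m \<Rightarrow> 'b) \<Rightarrow> bool" where
  "grid D \<xi> X \<eta> Y \<longleftrightarrow> linear_section_over_B D \<xi> X \<and> linear_section_over_A D \<eta> Y"

definition warp ::
  "('d, 'a, 'b, 'm, 'ed, 'ea, 'eb, 'em) dvb \<Rightarrow>
   ('b \<Rightarrow> 'd) \<Rightarrow> ('m \<Rightarrow> 'a) \<Rightarrow> ('a \<Rightarrow> 'd) \<Rightarrow> ('m \<Rightarrow> 'b) \<Rightarrow> 'm \<Rightarrow> 'd" where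
  "warp D \<xi> X \<eta> Y m = (THE c. c \<in> fibre (core D) m \<and>
     diff (DA D) (\<xi> (Y m)) (\<eta> (X m)) = add (DB D) c (zer (DA D) (X m)) \<and>
     diff (DB D) (\<xi> (Y m)) (\<eta> (X m)) = add (DA D) c (zer (DB D) (Y m)))"

text \<open>The function \<open>\<ell>\<^sub>w\<close> on the dual of a family.\<close>

definition linear_function :: "('x \<Rightarrow> 't) \<Rightarrow> 'x \<times> ('t \<Rightarrow> real) \<Rightarrow> real" where
  "linear_function w \<kappa> = pairing \<kappa> (w (fst \<kappa>))"


section \<open>The duals of a double vector bundle\<close>

text \<open>
  In this section \<open>VA\<close>, \<open>VB\<close>, \<open>WA\<close>, \<open>C\<close> stand for \<open>D \<rightarrow> A\<close>, \<open>D \<rightarrow> B\<close>, \<open>A \<rightarrow> M\<close> and the core, and also for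
  the same data with \<open>A\<close> and \<open>B\<close> exchanged. First the projection from the dual of \<open>D \<rightarrow> A\<close> to \<open>C\<^sup>*\<close>.
\<close>

definition core_prj ::
  "('d, 'a) family \<Rightarrow> ('d, 'b) family \<Rightarrow> ('a, 'm) family \<Rightarrow> ('d, 'm) family \<Rightarrow>
   'a \<times> ('d \<Rightarrow> real) \<Rightarrow> 'm \<times> ('d \<Rightarrow> real)" where
  "core_prj VA VB WA C \<Phi> =
     (let a = fst \<Phi>; m = prj WA a
      in (m, \<lambda>c\<in>fibre C m. pairing \<Phi> (add VB (zer VA a) c)))"

text \<open>
  The dual of \<open>D \<rightarrow> A\<close> as a bundle over \<open>C\<^sup>*\<close>. The operations must be told to preserve the projection to
  \<open>C\<^sup>*\<close>: for \<open>r = 0\<close> the condition on pairings alone does not determine the scalar multiple.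
\<close>

definition dual_over_core_dual ::
  "('d, 'a) family \<Rightarrow> ('d, 'b) family \<Rightarrow> ('a, 'm) family \<Rightarrow> ('d, 'm) family \<Rightarrow>
   ('a \<times> ('d \<Rightarrow> real), 'm \<times> ('d \<Rightarrow> real)) family" where
  "dual_over_core_dual VA VB WA C =
     \<lparr>tot = tot (dual VA),
      bas = tot (dual C),
      prj = core_prj VA VB WA C,
      add = (\<lambda>\<Phi> \<Phi>'. THE \<Omega>. \<Omega> \<in> fibre (dual VA) (add WA (fst \<Phi>) (fst \<Phi>')) \<and>
               core_prj VA VB WA C \<Omega> = core_prj VA VB WA C \<Phi> \<and>
               (\<forall>d\<in>fibre VA (fst \<Phi>). \<forall>d'\<in>fibre VA (fst \<Phi>'). prj VB d = prj VB d' \<longrightarrow>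
                  pairing \<Omega> (add VB d d') = pairing \<Phi> d + pairing \<Phi>' d')),
      smult = (\<lambda>r \<Phi>. THE \<Omega>. \<Omega> \<in> fibre (dual VA) (smult WA r (fst \<Phi>)) \<and>
               core_prj VA VB WA C \<Omega> = core_prj VA VB WA C \<Phi> \<and>
               (\<forall>d\<in>fibre VA (fst \<Phi>). pairing \<Omega> (smult VB r d) = r * pairing \<Phi> d))\<rparr>"

definition dual_A ::
  "('d, 'a, 'b, 'm, 'ed, 'ea, 'eb, 'em) dvb \<Rightarrow> ('a \<times> ('d \<Rightarrow> real), 'm \<times> ('d \<Rightarrow> real)) family" where
  "dual_A D = dual_over_core_dual (DA D) (DB D) (AM D) (core D)"

definition dual_B ::
  "('d, 'a, 'b, 'm, 'ed, 'ea, 'eb, 'em) dvb \<Rightarrow> ('b \<times> ('d \<Rightarrow> real), 'm \<times> ('d \<Rightarrow> real)) family" where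
  "dual_B D = dual_over_core_dual (DB D) (DA D) (BM D) (core D)"

text \<open>The pairing of the two duals over \<open>C\<^sup>*\<close>: the common value for all \<open>d\<close> with the required outline.\<close>

definition dual_pairing ::
  "('d, 'a, 'b, 'm, 'ed, 'ea, 'eb, 'em) dvb \<Rightarrow>
   'a \<times> ('d \<Rightarrow> real) \<Rightarrow> 'b \<times> ('d \<Rightarrow> real) \<Rightarrow> real" where
  "dual_pairing D \<Phi> \<Psi> =
     (THE r. \<forall>d\<in>tot (DA D). prj (DA D) d = fst \<Phi> \<and> prj (DB D) d = fst \<Psi> \<longrightarrow>
        r = pairing \<Phi> d - pairing \<Psi> d)"

definition Z_A ::
  "('d, 'a, 'b, 'm, 'ed, 'ea, 'eb, 'em) dvb \<Rightarrow> 'a \<times> ('d \<Rightarrow> real) \<Rightarrow>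
   ('m \<times> ('d \<Rightarrow> real)) \<times> ('b \<times> ('d \<Rightarrow> real) \<Rightarrow> real)" where
  "Z_A D \<Phi> = (THE \<Lambda>. \<Lambda> \<in> fibre (dual (dual_B D)) (prj (dual_A D) \<Phi>) \<and>
     (\<forall>\<Psi>\<in>fibre (dual_B D) (prj (dual_A D) \<Phi>). pairing \<Lambda> \<Psi> = dual_pairing D \<Phi> \<Psi>))"

text \<open>
  The section \<open>s\<^sup>\<sqinter>\<close> of the dual of \<open>P \<rightarrow> C\<^sup>*\<close>, where \<open>P\<close> is \<open>dual_A D\<close> or \<open>dual_B D\<close> and \<open>s\<close> is a linear
  section over \<open>A\<close> or \<open>B\<close> respectively; \<open>fst\<close> is the projection of \<open>P\<close> to \<open>A\<close> or \<open>B\<close>.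
\<close>

definition sqcap_section ::
  "('x \<times> ('d \<Rightarrow> real), 'k) family \<Rightarrow> ('x \<Rightarrow> 'd) \<Rightarrow> 'k \<Rightarrow> 'k \<times> ('x \<times> ('d \<Rightarrow> real) \<Rightarrow> real)" where
  "sqcap_section P s \<kappa> = (THE \<Lambda>. \<Lambda> \<in> fibre (dual P) \<kappa> \<and>
     (\<forall>\<Phi>\<in>fibre P \<kappa>. pairing \<Lambda> \<Phi> = pairing \<Phi> (s (fst \<Phi>))))"

definition section_bracket ::
  "('d, 'a, 'b, 'm, 'ed, 'ea, 'eb, 'em) dvb \<Rightarrow>
   ('m \<times> ('d \<Rightarrow> real) \<Rightarrow> ('m \<times> ('d \<Rightarrow> real)) \<times> ('b \<times> ('d \<Rightarrow> real) \<Rightarrow> real)) \<Rightarrow>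
   ('m \<times> ('d \<Rightarrow> real) \<Rightarrow> ('m \<times> ('d \<Rightarrow> real)) \<times> ('a \<times> ('d \<Rightarrow> real) \<Rightarrow> real)) \<Rightarrow>
   'm \<times> ('d \<Rightarrow> real) \<Rightarrow> real" where
  "section_bracket D \<sigma> \<tau> \<kappa> = pairing (\<tau> \<kappa>) (inv_into (tot (dual_A D)) (Z_A D) (\<sigma> \<kappa>))"

end

theory Submission
  imports Defs
begin

text \<open>
  The statement is pointwise over \<open>C\<^sup>*\<close>, so it is linear algebra in the fibres over one point \<open>m\<close>.
  Two elements of \<open>D\<close> with the same projections \<open>a\<close> and \<open>b\<close> differ by a unique core element \<open>c\<close>, and
  they do so with respect to both structures at once:
  \<open>d +\<^sub>A (c +\<^sub>B 0\<^sub>a) = d +\<^sub>B (c +\<^sub>A 0\<^sub>b)\<close>. Writing \<open>translate d c\<close> for this element, the core acts simply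
  transitively on the set of elements over \<open>(a, b)\<close>, compatibly with all operations; the warp is the
  core element that translates \<open>\<eta> (X m)\<close> to \<open>\<xi> (Y m)\<close>, and a covector lies over \<open>\<kappa>\<close> exactly if
  translation by \<open>c\<close> changes its value by \<open>\<kappa> c\<close>.

  A linear section \<open>\<zeta>\<close> over \<open>Z\<close> therefore provides, for each \<open>\<kappa>\<close>, a covector over \<open>Z m\<close> and \<open>\<kappa>\<close> that
  vanishes on \<open>\<zeta>\<close>, namely \<open>translate (\<zeta> b) c \<mapsto> \<kappa> c\<close> (\<open>vanishing_covector\<close>). It is used twice.

  First take the covector \<open>\<Phi>\<close> that vanishes on \<open>-\<^sub>B \<xi>\<close>. Evaluating the pairing of the two duals at
  \<open>d = -\<^sub>B \<xi> b\<close> gives \<open>\<parallel>\<Phi>, \<Psi>\<parallel> = 0 - \<langle>\<Psi>, -\<^sub>B \<xi> b\<rangle> = \<langle>\<Psi>, \<xi> b\<rangle>\<close>, so \<open>Z_A \<Phi> = \<xi>\<^sup>\<sqinter> \<kappa>\<close>: the section \<open>\<xi>\<^sup>\<sqinter>\<close>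
  takes values in the range of \<open>Z_A\<close>.

  Now let \<open>\<Phi>\<close> be any preimage of \<open>\<xi>\<^sup>\<sqinter> \<kappa>\<close>, lying over \<open>a\<close>, and test it against the covector \<open>\<Psi>\<close> over
  \<open>Y m\<close> that vanishes on \<open>\<eta>\<close>. Evaluating the pairing at \<open>d = \<eta> a\<close> gives
  \<open>\<langle>\<Phi>, \<eta> a\<rangle> = \<parallel>\<Phi>, \<Psi>\<parallel> = \<langle>\<Psi>, \<xi> (Y m)\<rangle> = \<langle>\<Psi>, \<eta> (X m)\<rangle> + \<kappa> (w m) = \<kappa> (w m)\<close> with \<open>w\<close> the warp, and the
  left-hand side is the bracket of \<open>\<xi>\<^sup>\<sqinter>\<close> and \<open>\<eta>\<^sup>\<sqinter>\<close> at \<open>\<kappa>\<close>, whichever preimage \<open>\<Phi>\<close> is taken.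

  Most of the work is to see that the descriptions defining the operations of the duals over \<open>C\<^sup>*\<close>
  (\<open>add_P\<close>, \<open>smult_P\<close>), the sections \<open>\<xi>\<^sup>\<sqinter>\<close>, \<open>\<eta>\<^sup>\<sqinter>\<close> and the map \<open>Z_A\<close> are met by exactly one object.
  The two scalar multiplications on the core agree for rational scalars by additivity, and for real
  ones by continuity (\<open>double_family_with_core_of_dvb\<close>).
\<close>

abbreviation fibre_plus ("(_ \<oplus>\<^bsub>_\<^esub> _)" [65, 0, 66] 65) where
  "u \<oplus>\<^bsub>V\<^esub> v \<equiv> add V u v"

abbreviation fibre_scale ("(_ \<odot>\<^bsub>_\<^esub> _)" [76, 0, 75] 75) where
  "r \<odot>\<^bsub>V\<^esub> v \<equiv> smult V r v"

section \<open>Fibrewise linear algebra\<close>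

locale fibrewise_vector_space =
  fixes V :: "('t, 'x) family"
  assumes family: "vector_space_family V"
begin

lemma base_of_fibre: "v \<in> fibre V x \<Longrightarrow> x \<in> bas V"
  using family by (auto simp: vector_space_family_def fibre_def)

lemmas fibre_laws = family[unfolded vector_space_family_def, THEN conjunct2, THEN bspec]

lemma add_closed: "u \<in> fibre V x \<Longrightarrow> v \<in> fibre V x \<Longrightarrow> u \<oplus>\<^bsub>V\<^esub> v \<in> fibre V x"
  using fibre_laws[OF base_of_fibre[of u x]] by simp

lemma add_comm: "u \<in> fibre V x \<Longrightarrow> v \<in> fibre V x \<Longrightarrow> u \<oplus>\<^bsub>V\<^esub> v = v \<oplus>\<^bsub>V\<^esub> u"
  using fibre_laws[OF base_of_fibre[of u x]] by simp

lemma add_assoc: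
  "u \<in> fibre V x \<Longrightarrow> v \<in> fibre V x \<Longrightarrow> w \<in> fibre V x \<Longrightarrow>
   u \<oplus>\<^bsub>V\<^esub> v \<oplus>\<^bsub>V\<^esub> w = u \<oplus>\<^bsub>V\<^esub> (v \<oplus>\<^bsub>V\<^esub> w)"
  using fibre_laws[OF base_of_fibre[of u x]] by blast

lemma smult_closed: "v \<in> fibre V x \<Longrightarrow> r \<odot>\<^bsub>V\<^esub> v \<in> fibre V x"
  using fibre_laws[OF base_of_fibre[of v x]] by simp

lemma smult_add:
  "u \<in> fibre V x \<Longrightarrow> v \<in> fibre V x \<Longrightarrow> r \<odot>\<^bsub>V\<^esub> (u \<oplus>\<^bsub>V\<^esub> v) = r \<odot>\<^bsub>V\<^esub> u \<oplus>\<^bsub>V\<^esub> r \<odot>\<^bsub>V\<^esub> v"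
  using fibre_laws[OF base_of_fibre[of u x]] by simp

lemma add_smult: "v \<in> fibre V x \<Longrightarrow> (r + s) \<odot>\<^bsub>V\<^esub> v = r \<odot>\<^bsub>V\<^esub> v \<oplus>\<^bsub>V\<^esub> s \<odot>\<^bsub>V\<^esub> v"
  using fibre_laws[OF base_of_fibre[of v x]] by simp

lemma smult_smult: "v \<in> fibre V x \<Longrightarrow> (r * s) \<odot>\<^bsub>V\<^esub> v = r \<odot>\<^bsub>V\<^esub> (s \<odot>\<^bsub>V\<^esub> v)"
  using fibre_laws[OF base_of_fibre[of v x]] by simp

lemma smult_one: "v \<in> fibre V x \<Longrightarrow> 1 \<odot>\<^bsub>V\<^esub> v = v"
  using fibre_laws[OF base_of_fibre[of v x]] by simp

lemma zero_and_negatives: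
  "x \<in> bas V \<Longrightarrow>
   \<exists>z\<in>fibre V x. \<forall>v\<in>fibre V x. z \<oplus>\<^bsub>V\<^esub> v = v \<and> (\<exists>w\<in>fibre V x. v \<oplus>\<^bsub>V\<^esub> w = z)"
  by (drule fibre_laws) (elim conjE, assumption)

lemma zer_spec:
  assumes "x \<in> bas V"
  shows "zer V x \<in> fibre V x \<and> (\<forall>v\<in>fibre V x. zer V x \<oplus>\<^bsub>V\<^esub> v = v)"
proof -
  obtain z where z: "z \<in> fibre V x" "\<forall>v\<in>fibre V x. z \<oplus>\<^bsub>V\<^esub> v = v"
    using zero_and_negatives[OF assms] by metis
  show ?thesis
    unfolding zer_def
  proof (rule theI[of _ z])
    fix z' assume "z' \<in> fibre V x \<and> (\<forall>v\<in>fibre V x. z' \<oplus>\<^bsub>V\<^esub> v = v)"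
    then show "z' = z"
      using z add_comm[of z x z'] by metis
  qed (use z in blast)
qed

lemma zer_closed: "x \<in> bas V \<Longrightarrow> zer V x \<in> fibre V x"
  using zer_spec by blast

lemma zer_add: "v \<in> fibre V x \<Longrightarrow> zer V x \<oplus>\<^bsub>V\<^esub> v = v"
  using zer_spec base_of_fibre by blast

lemma add_zer: "v \<in> fibre V x \<Longrightarrow> v \<oplus>\<^bsub>V\<^esub> zer V x = v"
  using zer_add add_comm zer_closed base_of_fibre by metis

lemma add_left_cancel:
  assumes "u \<in> fibre V x" "v \<in> fibre V x" "w \<in> fibre V x" "u \<oplus>\<^bsub>V\<^esub> v = u \<oplus>\<^bsub>V\<^esub> w"
  shows "v = w"
proof -
  have x: "x \<in> bas V"
    using assms(1) base_of_fibre by blast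
  then obtain z where z: "z \<in> fibre V x"
      "\<forall>v\<in>fibre V x. z \<oplus>\<^bsub>V\<^esub> v = v \<and> (\<exists>w\<in>fibre V x. v \<oplus>\<^bsub>V\<^esub> w = z)"
    using zero_and_negatives[OF x] by metis
  then obtain u' where u': "u' \<in> fibre V x" "u' \<oplus>\<^bsub>V\<^esub> u = z"
    using assms(1) add_comm by metis
  have "v = u' \<oplus>\<^bsub>V\<^esub> u \<oplus>\<^bsub>V\<^esub> v" "w = u' \<oplus>\<^bsub>V\<^esub> u \<oplus>\<^bsub>V\<^esub> w"
    using u' z assms by auto
  then show ?thesis
    using add_assoc[OF u'(1) assms(1)] assms by metis
qed

lemma zero_smult:
  assumes "v \<in> fibre V x"
  shows "0 \<odot>\<^bsub>V\<^esub> v = zer V x"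
proof -
  have "0 \<odot>\<^bsub>V\<^esub> v \<oplus>\<^bsub>V\<^esub> 0 \<odot>\<^bsub>V\<^esub> v = 0 \<odot>\<^bsub>V\<^esub> v \<oplus>\<^bsub>V\<^esub> zer V x"
    using add_smult[OF assms, of 0 0] add_zer[OF smult_closed[OF assms]] by simp
  then show ?thesis
    using add_left_cancel assms smult_closed zer_closed base_of_fibre by metis
qed

lemma smult_zer: "x \<in> bas V \<Longrightarrow> r \<odot>\<^bsub>V\<^esub> zer V x = zer V x"
  using smult_smult[OF zer_closed, of x r 0] zero_smult[OF zer_closed, of x] by simp

lemma add_neg:
  assumes "v \<in> fibre V x"
  shows "v \<oplus>\<^bsub>V\<^esub> (-1) \<odot>\<^bsub>V\<^esub> v = zer V x"
  using add_smult[OF assms, of 1 "-1"] smult_one[OF assms] zero_smult[OF assms] by simp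

lemma diff_closed: "u \<in> fibre V x \<Longrightarrow> v \<in> fibre V x \<Longrightarrow> diff V u v \<in> fibre V x"
  unfolding diff_def by (intro add_closed smult_closed)

lemma add_diff:
  assumes "u \<in> fibre V x" "v \<in> fibre V x"
  shows "v \<oplus>\<^bsub>V\<^esub> diff V u v = u"
proof -
  note v' = smult_closed[OF assms(2), of "-1"]
  have "v \<oplus>\<^bsub>V\<^esub> (u \<oplus>\<^bsub>V\<^esub> (-1) \<odot>\<^bsub>V\<^esub> v) = v \<oplus>\<^bsub>V\<^esub> ((-1) \<odot>\<^bsub>V\<^esub> v \<oplus>\<^bsub>V\<^esub> u)"
    using add_comm[OF assms(1) v'] by simp
  also have "\<dots> = v \<oplus>\<^bsub>V\<^esub> (-1) \<odot>\<^bsub>V\<^esub> v \<oplus>\<^bsub>V\<^esub> u"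
    using add_assoc[OF assms(2) v' assms(1)] by simp
  also have "\<dots> = u"
    using add_neg[OF assms(2)] zer_add[OF assms(1)] by simp
  finally show ?thesis
    by (simp add: diff_def)
qed

lemma diff_eq:
  assumes "v \<in> fibre V x" "w \<in> fibre V x" "u = v \<oplus>\<^bsub>V\<^esub> w"
  shows "diff V u v = w"
  using add_left_cancel[OF assms(1) diff_closed assms(2)] add_diff add_closed assms by metis

lemma add_add_swap:
  assumes "u \<in> fibre V x" "v \<in> fibre V x" "u' \<in> fibre V x" "v' \<in> fibre V x"
  shows "(u \<oplus>\<^bsub>V\<^esub> v) \<oplus>\<^bsub>V\<^esub> (u' \<oplus>\<^bsub>V\<^esub> v') = (u \<oplus>\<^bsub>V\<^esub> u') \<oplus>\<^bsub>V\<^esub> (v \<oplus>\<^bsub>V\<^esub> v')"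
proof -
  have "(u \<oplus>\<^bsub>V\<^esub> v) \<oplus>\<^bsub>V\<^esub> (u' \<oplus>\<^bsub>V\<^esub> v') = u \<oplus>\<^bsub>V\<^esub> (v \<oplus>\<^bsub>V\<^esub> u' \<oplus>\<^bsub>V\<^esub> v')"
    using add_assoc[OF assms(1,2) add_closed[OF assms(3,4)]] add_assoc[OF assms(2-4)] by simp
  also have "\<dots> = u \<oplus>\<^bsub>V\<^esub> (u' \<oplus>\<^bsub>V\<^esub> v \<oplus>\<^bsub>V\<^esub> v')"
    using add_comm[OF assms(2,3)] by simp
  also have "\<dots> = (u \<oplus>\<^bsub>V\<^esub> u') \<oplus>\<^bsub>V\<^esub> (v \<oplus>\<^bsub>V\<^esub> v')"
    using add_assoc[OF assms(1,3) add_closed[OF assms(2,4)]] add_assoc[OF assms(3,2,4)] by simp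
  finally show ?thesis .
qed

end

lemma fst_of_dual_fibre: "\<Lambda> \<in> fibre (dual V) x \<Longrightarrow> fst \<Lambda> = x"
  by (auto simp: fibre_def dual_def)

lemma base_of_dual_fibre: "\<Lambda> \<in> fibre (dual V) x \<Longrightarrow> x \<in> bas V"
  by (auto simp: fibre_def dual_def)

lemma dual_fibre_of_tot: "\<Lambda> \<in> tot (dual V) \<longleftrightarrow> \<Lambda> \<in> fibre (dual V) (fst \<Lambda>)"
  by (auto simp: fibre_def dual_def)

lemma pairing_add:
  "\<Lambda> \<in> fibre (dual V) x \<Longrightarrow> v \<in> fibre V x \<Longrightarrow> w \<in> fibre V x \<Longrightarrow>
   pairing \<Lambda> (v \<oplus>\<^bsub>V\<^esub> w) = pairing \<Lambda> v + pairing \<Lambda> w"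
  by (auto simp: fibre_def dual_def pairing_def)

lemma pairing_smult:
  "\<Lambda> \<in> fibre (dual V) x \<Longrightarrow> v \<in> fibre V x \<Longrightarrow> pairing \<Lambda> (r \<odot>\<^bsub>V\<^esub> v) = r * pairing \<Lambda> v"
  by (auto simp: fibre_def dual_def pairing_def)

lemma dual_eqI:
  assumes "\<Lambda> \<in> fibre (dual V) x" "\<Lambda>' \<in> fibre (dual V) x"
    and "\<And>v. v \<in> fibre V x \<Longrightarrow> pairing \<Lambda> v = pairing \<Lambda>' v"
  shows "\<Lambda> = \<Lambda>'"
proof (rule prod_eqI)
  have "snd \<Lambda> \<in> extensional (fibre V x)" "snd \<Lambda>' \<in> extensional (fibre V x)"
    using assms(1,2) by (auto simp: fibre_def dual_def)
  then show "snd \<Lambda> = snd \<Lambda>'"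
    using assms(3) by (auto simp: pairing_def intro: extensionalityI)
qed (use assms(1,2) fst_of_dual_fibre in metis)

text \<open>
  Every object that is defined by a description as an element of a dual is obtained from this. The
  closure of the fibre under the operations is part of the premises because for the duals over \<open>C\<^sup>*\<close>,
  whose operations are descriptions themselves, it is as hard to see as the linearity.
\<close>

lemma dual_ex1:
  assumes "x \<in> bas V"
    and "\<And>v w. v \<in> fibre V x \<Longrightarrow> w \<in> fibre V x \<Longrightarrow>
          v \<oplus>\<^bsub>V\<^esub> w \<in> fibre V x \<and> F (v \<oplus>\<^bsub>V\<^esub> w) = F v + F w"
    and "\<And>r v. v \<in> fibre V x \<Longrightarrow> r \<odot>\<^bsub>V\<^esub> v \<in> fibre V x \<and> F (r \<odot>\<^bsub>V\<^esub> v) = r * F v"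
  shows "\<exists>!\<Lambda>. \<Lambda> \<in> fibre (dual V) x \<and> (\<forall>v\<in>fibre V x. pairing \<Lambda> v = F v)"
proof (rule ex_ex1I)
  have "(x, restrict F (fibre V x)) \<in> fibre (dual V) x"
    unfolding fibre_def[of "dual V"] using assms by (auto simp: dual_def)
  then show "\<exists>\<Lambda>. \<Lambda> \<in> fibre (dual V) x \<and> (\<forall>v\<in>fibre V x. pairing \<Lambda> v = F v)"
    by (intro exI[of _ "(x, restrict F (fibre V x))"]) (simp add: pairing_def)
next
  fix \<Lambda> \<Lambda>'
  assume "\<Lambda> \<in> fibre (dual V) x \<and> (\<forall>v\<in>fibre V x. pairing \<Lambda> v = F v)"
    and "\<Lambda>' \<in> fibre (dual V) x \<and> (\<forall>v\<in>fibre V x. pairing \<Lambda>' v = F v)"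
  then show "\<Lambda> = \<Lambda>'"
    by (intro dual_eqI[of _ V x]) auto
qed

text \<open>
  The covectors needed below are given by a formula in terms of a choice, such as a decomposition of
  the argument. The graph, as a relation, needs no choice, and its linearity can be checked
  separately from its being single-valued.
\<close>

lemma (in fibrewise_vector_space) covector_of_linear_relation:
  assumes "x \<in> bas V"
    and total: "\<And>v. v \<in> fibre V x \<Longrightarrow> \<exists>r. R v r"
    and single_valued: "\<And>v r s. v \<in> fibre V x \<Longrightarrow> R v r \<Longrightarrow> R v s \<Longrightarrow> r = s"
    and add: "\<And>v w r s. v \<in> fibre V x \<Longrightarrow> w \<in> fibre V x \<Longrightarrow> R v r \<Longrightarrow> R w s \<Longrightarrow> R (v \<oplus>\<^bsub>V\<^esub> w) (r + s)"
    and smult: "\<And>v r k. v \<in> fibre V x \<Longrightarrow> R v r \<Longrightarrow> R (k \<odot>\<^bsub>V\<^esub> v) (k * r)"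
  shows "\<exists>\<Lambda>\<in>fibre (dual V) x. \<forall>v r. v \<in> fibre V x \<longrightarrow> R v r \<longrightarrow> pairing \<Lambda> v = r"
proof -
  define F where "F v = (THE r. R v r)" for v
  have F: "F v = r" if "v \<in> fibre V x" "R v r" for v r
    unfolding F_def using that single_valued by blast
  have "\<exists>!\<Lambda>. \<Lambda> \<in> fibre (dual V) x \<and> (\<forall>v\<in>fibre V x. pairing \<Lambda> v = F v)"
  proof (rule dual_ex1[OF assms(1)])
    fix v w assume vw: "v \<in> fibre V x" "w \<in> fibre V x"
    then obtain r s where "R v r" "R w s"
      using total by blast
    then show "v \<oplus>\<^bsub>V\<^esub> w \<in> fibre V x \<and> F (v \<oplus>\<^bsub>V\<^esub> w) = F v + F w"
      using vw add add_closed F by metis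
  next
    fix k v assume v: "v \<in> fibre V x"
    then obtain r where "R v r"
      using total by blast
    then show "k \<odot>\<^bsub>V\<^esub> v \<in> fibre V x \<and> F (k \<odot>\<^bsub>V\<^esub> v) = k * F v"
      using v smult smult_closed F by metis
  qed
  then show ?thesis
    using F by metis
qed

lemma morphism_zer:
  assumes "fibrewise_vector_space V" "fibrewise_vector_space W" "bundle_morphism V W F f" "x \<in> bas V"
  shows "F (zer V x) = zer W (f x)"
proof -
  interpret V: fibrewise_vector_space V by fact
  interpret W: fibrewise_vector_space W by fact
  note z = V.zer_closed[OF assms(4)]
  have "F (zer V x) = F (0 \<odot>\<^bsub>V\<^esub> zer V x)"
    using V.smult_zer[OF assms(4)] by simp
  also have "\<dots> = 0 \<odot>\<^bsub>W\<^esub> F (zer V x)" and "F (zer V x) \<in> fibre W (f x)"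
    using assms(3,4) z by (auto simp: bundle_morphism_def)
  ultimately show ?thesis
    using W.zero_smult by metis
qed

lemma morphism_comp:
  assumes "bundle_morphism V W F f" "bundle_morphism W U G g"
  shows "bundle_morphism V U (\<lambda>v. G (F v)) (\<lambda>x. g (f x))"
  unfolding bundle_morphism_def
proof
  fix x assume x: "x \<in> bas V"
  note F = bspec[OF assms(1)[unfolded bundle_morphism_def] x]
  note G = bspec[OF assms(2)[unfolded bundle_morphism_def] conjunct1[OF F]]
  show "g (f x) \<in> bas U \<and>
      (\<forall>v\<in>fibre V x. G (F v) \<in> fibre U (g (f x))) \<and>
      (\<forall>v\<in>fibre V x. \<forall>w\<in>fibre V x. G (F (v \<oplus>\<^bsub>V\<^esub> w)) = G (F v) \<oplus>\<^bsub>U\<^esub> G (F w)) \<and>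
      (\<forall>r. \<forall>v\<in>fibre V x. G (F (r \<odot>\<^bsub>V\<^esub> v)) = r \<odot>\<^bsub>U\<^esub> G (F v))"
    using F G by simp
qed

section \<open>Two commuting linear structures\<close>

text \<open>
  The fibrewise algebra of a double vector bundle, without topology. The assumptions are symmetric
  under the exchange of \<open>A\<close> and \<open>B\<close>, so every fact about the structure over \<open>A\<close> has a counterpart over \<open>B\<close>,
  available under the prefix \<open>swap\<close>. That an element \<open>d\<close> has outline \<open>(d; a, b; m)\<close> is expressed by its
  membership in the fibres over \<open>a\<close> and over \<open>b\<close>.
\<close>

locale double_family =
  A: fibrewise_vector_space VA + B: fibrewise_vector_space VB +
  WA: fibrewise_vector_space WA + WB: fibrewise_vector_space WB
  for VA :: "('d, 'a) family" and VB :: "('d, 'b) family"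
    and WA :: "('a, 'm) family" and WB :: "('b, 'm) family" +
  assumes tot_eq: "tot VA = tot VB"
    and bas_A: "bas VA = tot WA" and bas_B: "bas VB = tot WB" and bas_eq: "bas WA = bas WB"
    and prj_prj: "\<And>d. d \<in> tot VA \<Longrightarrow> prj WA (prj VA d) = prj WB (prj VB d)"
    and linear_A: "structure_maps_linear VA VB WA WB"
    and linear_B: "structure_maps_linear VB VA WB WA"
    and surj: "\<And>m a b. a \<in> fibre WA m \<Longrightarrow> b \<in> fibre WB m \<Longrightarrow> \<exists>d. d \<in> fibre VA a \<and> d \<in> fibre VB b"
begin

lemma swapped: "double_family VB VA WB WA"
  using tot_eq bas_A bas_B bas_eq prj_prj linear_A linear_B surj
  by unfold_locales metis+

lemma in_other_fibre: "d \<in> fibre VA a \<Longrightarrow> d \<in> fibre VB (prj VB d)"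
  using tot_eq by (auto simp: fibre_def)

lemma base_fibres:
  assumes "d \<in> fibre VA a" "d \<in> fibre VB b"
  shows "a \<in> fibre WA (prj WA a)" "b \<in> fibre WB (prj WA a)"
  using A.base_of_fibre[OF assms(1)] B.base_of_fibre[OF assms(2)] prj_prj[of d] assms
  by (auto simp: bas_A bas_B fibre_def)

lemma same_base:
  assumes "d \<in> fibre VA a" "d \<in> fibre VB b" "a \<in> fibre WA m"
  shows "b \<in> fibre WB m"
  using base_fibres[OF assms(1,2)] assms(3) by (auto simp: fibre_def)

lemma prj_morphism: "bundle_morphism VA WB (prj VB) (prj WA)"
  using linear_A by (simp add: structure_maps_linear_def)

lemma addA_over_B:
  assumes "d \<in> fibre VA a" "e \<in> fibre VA a" "d \<in> fibre VB b" "e \<in> fibre VB b'"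
  shows "d \<oplus>\<^bsub>VA\<^esub> e \<in> fibre VB (b \<oplus>\<^bsub>WB\<^esub> b')"
proof -
  have "prj VB (d \<oplus>\<^bsub>VA\<^esub> e) = prj VB d \<oplus>\<^bsub>WB\<^esub> prj VB e"
    using prj_morphism A.base_of_fibre[OF assms(1)] assms(1,2) by (simp add: bundle_morphism_def)
  then show ?thesis
    using A.add_closed[OF assms(1,2)] assms tot_eq by (simp add: fibre_def)
qed

lemma smultA_over_B:
  assumes "d \<in> fibre VA a" "d \<in> fibre VB b"
  shows "r \<odot>\<^bsub>VA\<^esub> d \<in> fibre VB (r \<odot>\<^bsub>WB\<^esub> b)"
proof -
  have "prj VB (r \<odot>\<^bsub>VA\<^esub> d) = r \<odot>\<^bsub>WB\<^esub> prj VB d"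
    using prj_morphism A.base_of_fibre[OF assms(1)] assms(1) by (simp add: bundle_morphism_def)
  then show ?thesis
    using A.smult_closed[OF assms(1)] assms tot_eq by (simp add: fibre_def)
qed

lemma zer_morphism: "bundle_morphism WA VB (zer VA) (zer WB)"
  using linear_B by (simp add: structure_maps_linear_def)

lemma zerA_closed: "a \<in> fibre WA m \<Longrightarrow> zer VA a \<in> fibre VA a"
  by (rule A.zer_closed) (simp add: bas_A fibre_def)

lemma zerA_over_B: "a \<in> fibre WA m \<Longrightarrow> zer VA a \<in> fibre VB (zer WB m)"
  using zer_morphism WA.base_of_fibre[of a m] by (simp add: bundle_morphism_def)

lemma zerA_add:
  "a \<in> fibre WA m \<Longrightarrow> a' \<in> fibre WA m \<Longrightarrow> zer VA (a \<oplus>\<^bsub>WA\<^esub> a') = zer VA a \<oplus>\<^bsub>VB\<^esub> zer VA a'"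
  using zer_morphism WA.base_of_fibre[of a m] by (simp add: bundle_morphism_def)

lemma zerA_smult: "a \<in> fibre WA m \<Longrightarrow> zer VA (r \<odot>\<^bsub>WA\<^esub> a) = r \<odot>\<^bsub>VB\<^esub> zer VA a"
  using zer_morphism WA.base_of_fibre[of a m] by (simp add: bundle_morphism_def)

text \<open>
  The zero section of \<open>D \<rightarrow> A\<close> is linear, hence sends the zero of \<open>A\<close> to the zero of \<open>D \<rightarrow> B\<close>.
\<close>

lemma zer_zer:
  "m \<in> bas WA \<Longrightarrow> zer VA (zer WA m) = zer VB (zer WB m)"
  using morphism_zer[OF WA.fibrewise_vector_space_axioms B.fibrewise_vector_space_axioms zer_morphism] .

lemma interchange:
  assumes "d \<in> fibre VA a" "e \<in> fibre VA a" "d' \<in> fibre VA a'" "e' \<in> fibre VA a'"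
    and "d \<in> fibre VB b" "d' \<in> fibre VB b" "e \<in> fibre VB b'" "e' \<in> fibre VB b'"
  shows "(d \<oplus>\<^bsub>VA\<^esub> e) \<oplus>\<^bsub>VB\<^esub> (d' \<oplus>\<^bsub>VA\<^esub> e') = (d \<oplus>\<^bsub>VB\<^esub> d') \<oplus>\<^bsub>VA\<^esub> (e \<oplus>\<^bsub>VB\<^esub> e')"
proof -
  let ?S = "fibre_square VA VB WA"
  have "prj WA a = prj WA a'"
    using base_fibres(2)[OF assms(1,5)] base_fibres(2)[OF assms(3,6)] by (simp add: fibre_def)
  then have "(a, a') \<in> bas ?S"
    using A.base_of_fibre[OF assms(1)] A.base_of_fibre[OF assms(3)] by (simp add: fibre_square_def)
  moreover have "(d, d') \<in> fibre ?S (a, a')" "(e, e') \<in> fibre ?S (a, a')"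
    using assms by (auto simp: fibre_square_def fibre_def)
  moreover have "bundle_morphism ?S VA (\<lambda>(d, d'). d \<oplus>\<^bsub>VB\<^esub> d') (\<lambda>(a, a'). a \<oplus>\<^bsub>WA\<^esub> a')"
    using linear_A unfolding structure_maps_linear_def by blast
  ultimately have "(\<lambda>(d, d'). d \<oplus>\<^bsub>VB\<^esub> d') (add ?S (d, d') (e, e')) = (d \<oplus>\<^bsub>VB\<^esub> d') \<oplus>\<^bsub>VA\<^esub> (e \<oplus>\<^bsub>VB\<^esub> e')"
    unfolding bundle_morphism_def by fastforce
  then show ?thesis
    by (simp add: fibre_square_def)
qed

lemma smultA_addB:
  assumes "d \<in> fibre VA a" "d' \<in> fibre VA a'" "d \<in> fibre VB b" "d' \<in> fibre VB b"
  shows "r \<odot>\<^bsub>VA\<^esub> (d \<oplus>\<^bsub>VB\<^esub> d') = r \<odot>\<^bsub>VA\<^esub> d \<oplus>\<^bsub>VB\<^esub> r \<odot>\<^bsub>VA\<^esub> d'"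
proof -
  have "bundle_morphism VB VB (smult VA r) (smult WB r)"
    using linear_B unfolding structure_maps_linear_def by blast
  then show ?thesis
    using assms B.base_of_fibre[OF assms(3)] by (simp add: bundle_morphism_def)
qed

lemma smult_commute:
  assumes "d \<in> fibre VA a"
  shows "r \<odot>\<^bsub>VA\<^esub> (s \<odot>\<^bsub>VB\<^esub> d) = s \<odot>\<^bsub>VB\<^esub> (r \<odot>\<^bsub>VA\<^esub> d)"
proof -
  have "bundle_morphism VA VA (smult VB s) (smult WA s)"
    using linear_A unfolding structure_maps_linear_def by blast
  then show ?thesis
    using assms A.base_of_fibre[OF assms] by (simp add: bundle_morphism_def)
qed

end

sublocale double_family \<subseteq> swap: double_family VB VA WB WA
  by (rule swapped)

context double_family
begin

definition core_fibre :: "'m \<Rightarrow> 'd set" where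
  "core_fibre m = {c. m \<in> bas WA \<and> c \<in> fibre VA (zer WA m) \<and> c \<in> fibre VB (zer WB m)}"

end

context double_family
begin

lemma core_fibreD:
  assumes "c \<in> core_fibre m"
  shows "m \<in> bas WA" "m \<in> bas WB" "c \<in> fibre VA (zer WA m)" "c \<in> fibre VB (zer WB m)"
    "zer WA m \<in> fibre WA m" "zer WB m \<in> fibre WB m"
  using assms bas_eq WA.zer_closed WB.zer_closed by (auto simp: core_fibre_def)

lemma core_zer: "m \<in> bas WA \<Longrightarrow> zer VA (zer WA m) \<in> core_fibre m"
  using zerA_closed[OF WA.zer_closed] zerA_over_B[OF WA.zer_closed] by (simp add: core_fibre_def)

lemma core_addA:
  assumes "c \<in> core_fibre m" "c' \<in> core_fibre m"
  shows "c \<oplus>\<^bsub>VA\<^esub> c' \<in> core_fibre m"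
  using core_fibreD[OF assms(1)] core_fibreD[OF assms(2)] A.add_closed
    addA_over_B[of c "zer WA m" c' "zer WB m" "zer WB m"] WB.zer_add
  by (auto simp: core_fibre_def)

lemma core_smultA:
  assumes "c \<in> core_fibre m"
  shows "r \<odot>\<^bsub>VA\<^esub> c \<in> core_fibre m"
  using core_fibreD[OF assms] A.smult_closed smultA_over_B[of c "zer WA m" "zer WB m" r] WB.smult_zer
  by (auto simp: core_fibre_def)

text \<open>
  The Eckmann--Hilton argument: the two additions satisfy the interchange law and have the same
  neutral element.
\<close>

lemma core_add_eq:
  assumes "c \<in> core_fibre m" "c' \<in> core_fibre m"
  shows "c \<oplus>\<^bsub>VA\<^esub> c' = c \<oplus>\<^bsub>VB\<^esub> c'"
proof -
  let ?z = "zer VA (zer WA m)"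
  note c = core_fibreD[OF assms(1)] and c' = core_fibreD[OF assms(2)]
  note z = core_fibreD[OF core_zer[OF c(1)]]
  have "(c \<oplus>\<^bsub>VA\<^esub> ?z) \<oplus>\<^bsub>VB\<^esub> (?z \<oplus>\<^bsub>VA\<^esub> c') = (c \<oplus>\<^bsub>VB\<^esub> ?z) \<oplus>\<^bsub>VA\<^esub> (?z \<oplus>\<^bsub>VB\<^esub> c')"
    using interchange c c' z by blast
  moreover have "c \<oplus>\<^bsub>VA\<^esub> ?z = c" "?z \<oplus>\<^bsub>VA\<^esub> c' = c'" "c \<oplus>\<^bsub>VB\<^esub> ?z = c" "?z \<oplus>\<^bsub>VB\<^esub> c' = c'"
    using A.add_zer A.zer_add B.add_zer B.zer_add c c' zer_zer[OF c(1)] by metis+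
  ultimately show ?thesis
    by simp
qed

lemma core_nat_smult_eq:
  assumes "c \<in> core_fibre m"
  shows "of_nat n \<odot>\<^bsub>VA\<^esub> c = of_nat n \<odot>\<^bsub>VB\<^esub> c"
proof (induction n)
  case 0
  then show ?case
    using A.zero_smult B.zero_smult core_fibreD[OF assms] zer_zer by simp
next
  case (Suc n)
  have "(1 + of_nat n) \<odot>\<^bsub>VA\<^esub> c = c \<oplus>\<^bsub>VA\<^esub> of_nat n \<odot>\<^bsub>VA\<^esub> c"
    using A.add_smult[of c _ 1] A.smult_one core_fibreD(3)[OF assms] by metis
  moreover have "(1 + of_nat n) \<odot>\<^bsub>VB\<^esub> c = c \<oplus>\<^bsub>VB\<^esub> of_nat n \<odot>\<^bsub>VB\<^esub> c"
    using B.add_smult[of c _ 1] B.smult_one core_fibreD(4)[OF assms] by metis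
  ultimately show ?case
    using Suc core_add_eq[OF assms core_smultA[OF assms, of "of_nat n"]] by simp
qed

lemma core_fibre_swap: "swap.core_fibre = core_fibre"
  using bas_eq by (auto simp: core_fibre_def swap.core_fibre_def fun_eq_iff)

lemma core_neg_smult_eq:
  assumes "c \<in> core_fibre m"
  shows "(-1) \<odot>\<^bsub>VA\<^esub> c = (-1) \<odot>\<^bsub>VB\<^esub> c"
proof -
  note c = core_fibreD[OF assms]
  have "c \<oplus>\<^bsub>VB\<^esub> (-1) \<odot>\<^bsub>VA\<^esub> c = c \<oplus>\<^bsub>VB\<^esub> (-1) \<odot>\<^bsub>VB\<^esub> c"
    using A.add_neg B.add_neg c zer_zer[OF c(1)] core_add_eq[OF assms core_smultA[OF assms]] by metis
  then show ?thesis
    using B.add_left_cancel c core_fibreD(4)[OF core_smultA[OF assms]] B.smult_closed by metis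
qed

text \<open>
  Agreement of the additions forces agreement of the scalar multiplications over the rational
  numbers, and the algebraic axioms give no more: a real vector space can be twisted by a
  discontinuous embedding of the field of real numbers into the complex numbers.
\<close>

lemma core_rat_smult_eq:
  assumes c: "c \<in> core_fibre m" and "q \<in> \<rat>"
  shows "q \<odot>\<^bsub>VA\<^esub> c = q \<odot>\<^bsub>VB\<^esub> c"
proof -
  have pos: "q \<odot>\<^bsub>VA\<^esub> c = q \<odot>\<^bsub>VB\<^esub> c" if q: "q \<in> \<rat>" "q \<ge> 0" and c: "c \<in> core_fibre m" for q c
  proof -
    obtain k n where n: "n \<noteq> 0" and "\<bar>q\<bar> = of_nat k / of_nat n"
      using Rats_abs_nat_div_natE[OF q(1)] by metis
    then have q': "of_nat n * q = of_nat k" "(1 / of_nat n) * (of_nat n * r) = r" for r :: real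
      using q(2) by auto
    have cB: "c \<in> fibre VB (zer WB m)" and cA: "c \<in> fibre VA (zer WA m)"
      and qc: "q \<odot>\<^bsub>VA\<^esub> c \<in> fibre VB (zer WB m)"
      using core_fibreD c core_smultA[OF c, of q] by blast+
    have "of_nat n \<odot>\<^bsub>VB\<^esub> (q \<odot>\<^bsub>VA\<^esub> c) = of_nat n \<odot>\<^bsub>VA\<^esub> (q \<odot>\<^bsub>VA\<^esub> c)"
      using core_nat_smult_eq[OF core_smultA[OF c, of q]] by simp
    also have "\<dots> = of_nat k \<odot>\<^bsub>VA\<^esub> c"
      using A.smult_smult[OF cA] q' by metis
    also have "\<dots> = of_nat n \<odot>\<^bsub>VB\<^esub> (q \<odot>\<^bsub>VB\<^esub> c)"
      using core_nat_smult_eq[OF c] B.smult_smult[OF cB] q' by metis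
    finally have "(1 / of_nat n * of_nat n) \<odot>\<^bsub>VB\<^esub> (q \<odot>\<^bsub>VA\<^esub> c) = (1 / of_nat n * of_nat n) \<odot>\<^bsub>VB\<^esub> (q \<odot>\<^bsub>VB\<^esub> c)"
      using B.smult_smult[OF qc] B.smult_smult[OF B.smult_closed[OF cB]] by metis
    then show ?thesis
      using n B.smult_one[OF qc] B.smult_one[OF B.smult_closed[OF cB]] by simp
  qed
  show ?thesis
  proof (cases "q \<ge> 0")
    case True
    then show ?thesis
      using pos assms by blast
  next
    case False
    then have "(-q) \<odot>\<^bsub>VA\<^esub> ((-1) \<odot>\<^bsub>VA\<^esub> c) = (-q) \<odot>\<^bsub>VB\<^esub> ((-1) \<odot>\<^bsub>VA\<^esub> c)"
      using pos[of "-q"] assms core_smultA[OF c] by simp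
    then have "(-q) \<odot>\<^bsub>VA\<^esub> ((-1) \<odot>\<^bsub>VA\<^esub> c) = (-q) \<odot>\<^bsub>VB\<^esub> ((-1) \<odot>\<^bsub>VB\<^esub> c)"
      using core_neg_smult_eq[OF c] by simp
    then show ?thesis
      using A.smult_smult[of c _ "-q" "-1"] B.smult_smult[of c _ "-q" "-1"] core_fibreD[OF c] by simp
  qed
qed

section \<open>The action of the core\<close>

text \<open>
  The action of the core on \<open>D\<close> in terms of the addition over \<open>A\<close>; by \<open>translate_B\<close> below the addition
  over \<open>B\<close> gives the same action.
\<close>

definition translate :: "'d \<Rightarrow> 'd \<Rightarrow> 'd" where
  "translate d c = d \<oplus>\<^bsub>VA\<^esub> (c \<oplus>\<^bsub>VB\<^esub> zer VA (prj VA d))"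

lemma core_plus_zer:
  assumes "c \<in> core_fibre m" "a \<in> fibre WA m"
  shows "c \<oplus>\<^bsub>VB\<^esub> zer VA a \<in> fibre VA a" "c \<oplus>\<^bsub>VB\<^esub> zer VA a \<in> fibre VB (zer WB m)"
  using swap.addA_over_B[of c "zer WB m" "zer VA a" "zer WA m" a] B.add_closed
    core_fibreD[OF assms(1)] zerA_closed[OF assms(2)] zerA_over_B[OF assms(2)] WA.zer_add[OF assms(2)]
  by auto

lemma translate_A:
  assumes "d \<in> fibre VA a" "c \<in> core_fibre m" "a \<in> fibre WA m"
  shows "translate d c = d \<oplus>\<^bsub>VA\<^esub> (c \<oplus>\<^bsub>VB\<^esub> zer VA a)"
  using assms(1) by (simp add: translate_def fibre_def)

text \<open>
  Write \<open>d = d +\<^sub>A 0\<^sub>a = d +\<^sub>B 0\<^sub>b\<close> and apply the interchange law to \<open>(d +\<^sub>A 0\<^sub>a) +\<^sub>B (0\<^sub>b +\<^sub>A c)\<close>.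
\<close>

lemma translate_B:
  assumes "d \<in> fibre VA a" "d \<in> fibre VB b" "c \<in> core_fibre m" "a \<in> fibre WA m"
  shows "translate d c = d \<oplus>\<^bsub>VB\<^esub> (c \<oplus>\<^bsub>VA\<^esub> zer VB b)"
proof -
  note b = same_base[OF assms(1,2,4)] and c = core_fibreD[OF assms(3)]
  note za = zerA_closed[OF assms(4)] zerA_over_B[OF assms(4)]
  note zb = swap.zerA_closed[OF b] swap.zerA_over_B[OF b]
  have "(d \<oplus>\<^bsub>VA\<^esub> zer VA a) \<oplus>\<^bsub>VB\<^esub> (zer VB b \<oplus>\<^bsub>VA\<^esub> c) = (d \<oplus>\<^bsub>VB\<^esub> zer VB b) \<oplus>\<^bsub>VA\<^esub> (zer VA a \<oplus>\<^bsub>VB\<^esub> c)"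
    using interchange assms(1,2) c za zb by blast
  moreover have "zer VB b \<oplus>\<^bsub>VA\<^esub> c = c \<oplus>\<^bsub>VA\<^esub> zer VB b" "zer VA a \<oplus>\<^bsub>VB\<^esub> c = c \<oplus>\<^bsub>VB\<^esub> zer VA a"
    using A.add_comm B.add_comm c za zb by blast+
  ultimately show ?thesis
    using A.add_zer[OF assms(1)] B.add_zer[OF assms(2)] translate_A[OF assms(1,3,4)] by simp
qed

end

context double_family
begin

lemma translate_swap:
  assumes "d \<in> fibre VA a" "d \<in> fibre VB b" "c \<in> core_fibre m" "a \<in> fibre WA m"
  shows "swap.translate d c = translate d c"
  using translate_B[OF assms] assms(2) by (simp add: swap.translate_def fibre_def)

lemma translate_over_A:
  assumes "d \<in> fibre VA a" "c \<in> core_fibre m" "a \<in> fibre WA m"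
  shows "translate d c \<in> fibre VA a"
  using translate_A[OF assms] A.add_closed[OF assms(1) core_plus_zer(1)[OF assms(2,3)]] by simp

end

context double_family
begin

lemma translate_over_B:
  assumes "d \<in> fibre VA a" "d \<in> fibre VB b" "c \<in> core_fibre m" "a \<in> fibre WA m"
  shows "translate d c \<in> fibre VB b"
  using swap.translate_over_A[OF assms(2), of c m] translate_swap[OF assms] assms(3)
    same_base[OF assms(1,2,4)] core_fibre_swap by simp

lemma translate_free:
  assumes "d \<in> fibre VA a" "c \<in> core_fibre m" "c' \<in> core_fibre m" "a \<in> fibre WA m"
    and "translate d c = translate d c'"
  shows "c = c'"
proof -
  have "c \<oplus>\<^bsub>VB\<^esub> zer VA a = c' \<oplus>\<^bsub>VB\<^esub> zer VA a"
    using assms translate_A A.add_left_cancel core_plus_zer by metis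
  then show ?thesis
    using B.add_left_cancel B.add_comm core_fibreD(4)[OF assms(2)] core_fibreD(4)[OF assms(3)]
      zerA_over_B[OF assms(4)] by metis
qed

text \<open>
  The difference \<open>e -\<^sub>A d\<close> projects to \<open>a\<close> in \<open>A\<close> and to zero in \<open>B\<close>; subtracting \<open>0\<^sub>a\<close> over \<open>B\<close> leaves an
  element that projects to zero in both.
\<close>

lemma translate_transitive:
  assumes "d \<in> fibre VA a" "e \<in> fibre VA a" "d \<in> fibre VB b" "e \<in> fibre VB b" "a \<in> fibre WA m"
  obtains c where "c \<in> core_fibre m" "e = translate d c"
proof -
  note b = same_base[OF assms(1,3,5)] and za = zerA_closed[OF assms(5)] zerA_over_B[OF assms(5)]
  have "diff VA e d \<in> fibre VB (b \<oplus>\<^bsub>WB\<^esub> (-1) \<odot>\<^bsub>WB\<^esub> b)"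
    unfolding diff_def
    using addA_over_B smultA_over_B A.smult_closed assms by blast
  then have f: "diff VA e d \<in> fibre VB (zer WB m)" "diff VA e d \<in> fibre VA a"
    using WB.add_neg[OF b] A.diff_closed assms by auto
  define c where "c = diff VB (diff VA e d) (zer VA a)"
  have "c \<in> fibre VA (a \<oplus>\<^bsub>WA\<^esub> (-1) \<odot>\<^bsub>WA\<^esub> a)"
    unfolding c_def diff_def[of VB]
    using swap.addA_over_B swap.smultA_over_B B.smult_closed f za by blast
  moreover have "c \<in> fibre VB (zer WB m)"
    unfolding c_def using B.diff_closed f za by blast
  ultimately have c: "c \<in> core_fibre m"
    using WA.add_neg[OF assms(5)] WA.base_of_fibre[OF assms(5)] by (simp add: core_fibre_def)
  have "c \<oplus>\<^bsub>VB\<^esub> zer VA a = diff VA e d"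
    using B.add_diff[OF f(1) za(2)] B.add_comm[OF za(2)] core_fibreD(4)[OF c] by (simp add: c_def)
  then have "e = translate d c"
    using A.add_diff[OF assms(2,1)] translate_A[OF assms(1) c assms(5)] by simp
  then show ?thesis
    using that c by blast
qed

lemma translate_addA:
  assumes "d \<in> fibre VA a" "d' \<in> fibre VA a" "c \<in> core_fibre m" "c' \<in> core_fibre m" "a \<in> fibre WA m"
  shows "translate d c \<oplus>\<^bsub>VA\<^esub> translate d' c' = translate (d \<oplus>\<^bsub>VA\<^esub> d') (c \<oplus>\<^bsub>VA\<^esub> c')"
proof -
  note za = zerA_closed[OF assms(5)] zerA_over_B[OF assms(5)]
  have "translate d c \<oplus>\<^bsub>VA\<^esub> translate d' c' =
      (d \<oplus>\<^bsub>VA\<^esub> d') \<oplus>\<^bsub>VA\<^esub> ((c \<oplus>\<^bsub>VB\<^esub> zer VA a) \<oplus>\<^bsub>VA\<^esub> (c' \<oplus>\<^bsub>VB\<^esub> zer VA a))"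
    using translate_A[OF assms(1,3,5)] translate_A[OF assms(2,4,5)]
      A.add_add_swap[OF assms(1) core_plus_zer(1)[OF assms(3,5)]
        assms(2) core_plus_zer(1)[OF assms(4,5)]] by simp
  also have "(c \<oplus>\<^bsub>VB\<^esub> zer VA a) \<oplus>\<^bsub>VA\<^esub> (c' \<oplus>\<^bsub>VB\<^esub> zer VA a) = (c \<oplus>\<^bsub>VA\<^esub> c') \<oplus>\<^bsub>VB\<^esub> (zer VA a \<oplus>\<^bsub>VA\<^esub> zer VA a)"
    using interchange[of c "zer WA m" c' "zer VA a" a "zer VA a"] core_fibreD assms za by metis
  also have "zer VA a \<oplus>\<^bsub>VA\<^esub> zer VA a = zer VA a"
    using A.add_zer za by blast
  finally show ?thesis
    using translate_A[OF A.add_closed[OF assms(1,2)] core_addA[OF assms(3,4)] assms(5)] by simp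
qed

lemma translate_smultA:
  assumes "d \<in> fibre VA a" "c \<in> core_fibre m" "a \<in> fibre WA m"
  shows "r \<odot>\<^bsub>VA\<^esub> translate d c = translate (r \<odot>\<^bsub>VA\<^esub> d) (r \<odot>\<^bsub>VA\<^esub> c)"
proof -
  note za = zerA_closed[OF assms(3)] zerA_over_B[OF assms(3)]
  have "r \<odot>\<^bsub>VA\<^esub> translate d c = r \<odot>\<^bsub>VA\<^esub> d \<oplus>\<^bsub>VA\<^esub> r \<odot>\<^bsub>VA\<^esub> (c \<oplus>\<^bsub>VB\<^esub> zer VA a)"
    using A.smult_add[OF assms(1) core_plus_zer(1)[OF assms(2,3)]] translate_A[OF assms] by simp
  also have "r \<odot>\<^bsub>VA\<^esub> (c \<oplus>\<^bsub>VB\<^esub> zer VA a) = r \<odot>\<^bsub>VA\<^esub> c \<oplus>\<^bsub>VB\<^esub> r \<odot>\<^bsub>VA\<^esub> zer VA a"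
    using smultA_addB core_fibreD[OF assms(2)] za by blast
  also have "r \<odot>\<^bsub>VA\<^esub> zer VA a = zer VA a"
    using A.smult_zer A.base_of_fibre[OF za(1)] by blast
  finally show ?thesis
    using translate_A[OF A.smult_closed[OF assms(1)] core_smultA[OF assms(2)] assms(3)] by simp
qed

lemma translate_zer:
  assumes "d \<in> fibre VA a" "a \<in> fibre WA m"
  shows "translate d (zer VA (zer WA m)) = d"
proof -
  have "zer VA (zer WA m) \<oplus>\<^bsub>VB\<^esub> zer VA a = zer VA a"
    using zer_zer[OF WA.base_of_fibre[OF assms(2)]] B.zer_add zerA_over_B[OF assms(2)] by simp
  then show ?thesis
    using translate_A[OF assms(1) core_zer assms(2)] WA.base_of_fibre[OF assms(2)] A.add_zer assms(1)
    by simp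
qed

lemma translate_translate:
  assumes "d \<in> fibre VA a" "c \<in> core_fibre m" "c' \<in> core_fibre m" "a \<in> fibre WA m"
  shows "translate (translate d c) c' = translate d (c \<oplus>\<^bsub>VA\<^esub> c')"
proof -
  note z = zerA_closed[OF assms(4)]
  have "translate (translate d c) c' = translate d c \<oplus>\<^bsub>VA\<^esub> translate (zer VA a) c'"
    using translate_A[OF translate_over_A[OF assms(1,2,4)] assms(3,4)] translate_A[OF z assms(3,4)]
      A.zer_add[OF core_plus_zer(1)[OF assms(3,4)]] by simp
  also have "\<dots> = translate (d \<oplus>\<^bsub>VA\<^esub> zer VA a) (c \<oplus>\<^bsub>VA\<^esub> c')"
    using translate_addA[OF assms(1) z assms(2-4)] .
  finally show ?thesis
    using A.add_zer[OF assms(1)] by simp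
qed

lemma zer_addB_core:
  assumes "c \<in> core_fibre m" "a \<in> fibre WA m"
  shows "zer VA a \<oplus>\<^bsub>VB\<^esub> c = translate (zer VA a) c"
  using translate_A[OF zerA_closed[OF assms(2)] assms] A.zer_add[OF core_plus_zer(1)[OF assms]]
    B.add_comm[OF zerA_over_B[OF assms(2)] core_fibreD(4)[OF assms(1)]] by simp

end

section \<open>The duals over the dual of the core\<close>

text \<open>
  The core as a family \<open>C\<close> of its own. Its operations are those over \<open>A\<close>; assuming in addition that the
  two scalar multiplications agree on it makes the assumptions symmetric in \<open>A\<close> and \<open>B\<close> again.
\<close>

locale double_family_with_core = double_family VA VB WA WB
  for VA :: "('d, 'a) family" and VB :: "('d, 'b) family"
    and WA :: "('a, 'm) family" and WB :: "('b, 'm) family" +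
  fixes C :: "('d, 'm) family"
  assumes core_bas: "bas C = bas WA"
    and fibre_core: "\<And>m. m \<in> bas WA \<Longrightarrow> fibre C m = core_fibre m"
    and core_add: "\<And>m c c'. c \<in> core_fibre m \<Longrightarrow> c' \<in> core_fibre m \<Longrightarrow> c \<oplus>\<^bsub>C\<^esub> c' = c \<oplus>\<^bsub>VA\<^esub> c'"
    and core_smult: "\<And>m c r. c \<in> core_fibre m \<Longrightarrow> r \<odot>\<^bsub>C\<^esub> c = r \<odot>\<^bsub>VA\<^esub> c"
    and core_smult_eq: "\<And>m c r. c \<in> core_fibre m \<Longrightarrow> r \<odot>\<^bsub>VA\<^esub> c = r \<odot>\<^bsub>VB\<^esub> c"
begin

lemma swapped_core: "double_family_with_core VB VA WB WA C"
  using core_bas fibre_core core_add core_smult core_smult_eq core_add_eq bas_eq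
  by unfold_locales (simp_all add: core_fibre_swap)

end

sublocale double_family_with_core \<subseteq> swap: double_family_with_core VB VA WB WA C
  by (rule swapped_core)

context double_family_with_core
begin

abbreviation P :: "('a \<times> ('d \<Rightarrow> real), 'm \<times> ('d \<Rightarrow> real)) family" where
  "P \<equiv> dual_over_core_dual VA VB WA C"

lemma kappa_add:
  assumes "\<kappa> \<in> fibre (dual C) m" "c \<in> core_fibre m" "c' \<in> core_fibre m"
  shows "pairing \<kappa> (c \<oplus>\<^bsub>VA\<^esub> c') = pairing \<kappa> c + pairing \<kappa> c'"
  using pairing_add[OF assms(1), of c c'] assms(2,3) core_add[OF assms(2,3)]
    fibre_core[OF core_fibreD(1)[OF assms(2)]] by simp

lemma kappa_smult:
  assumes "\<kappa> \<in> fibre (dual C) m" "c \<in> core_fibre m"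
  shows "pairing \<kappa> (r \<odot>\<^bsub>VA\<^esub> c) = r * pairing \<kappa> c"
  using pairing_smult[OF assms(1), of c r] assms(2) core_smult[OF assms(2)]
    fibre_core[OF core_fibreD(1)[OF assms(2)]] by simp

lemma kappa_base:
  assumes "\<kappa> \<in> fibre (dual C) m"
  shows "m \<in> bas WA" "m \<in> bas WB" "fst \<kappa> = m"
  using base_of_dual_fibre[OF assms] core_bas bas_eq fst_of_dual_fibre[OF assms] by auto

lemma kappa_zer:
  assumes "\<kappa> \<in> fibre (dual C) m"
  shows "pairing \<kappa> (zer VA (zer WA m)) = 0"
  using kappa_smult[OF assms core_zer[OF kappa_base(1)[OF assms]], of 0]
    A.zero_smult[OF core_fibreD(3)[OF core_zer[OF kappa_base(1)[OF assms]]]] by simp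

text \<open>
  The defining condition of the projection to \<open>C\<^sup>*\<close> compares the covector with \<open>\<kappa>\<close> on the translates of
  \<open>0\<^sub>a\<close> only; by linearity it then holds for the translates of every element (\<open>pairing_translate\<close> below).
\<close>

lemma fibre_PI:
  assumes "\<Phi> \<in> fibre (dual VA) a" "a \<in> fibre WA m" "\<kappa> \<in> fibre (dual C) m"
    and "\<And>c. c \<in> core_fibre m \<Longrightarrow> pairing \<Phi> (translate (zer VA a) c) = pairing \<kappa> c"
  shows "\<Phi> \<in> fibre P \<kappa>"
proof -
  have m: "fibre C m = core_fibre m"
    using fibre_core kappa_base[OF assms(3)] by simp
  have a: "fst \<Phi> = a" and "prj WA a = m"
    using assms(2) fst_of_dual_fibre[OF assms(1)] by (auto simp: fibre_def)
  moreover have "(\<lambda>c\<in>fibre C m. pairing \<Phi> (zer VA a \<oplus>\<^bsub>VB\<^esub> c)) = snd \<kappa>"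
  proof (rule extensionalityI)
    show "snd \<kappa> \<in> extensional (fibre C m)"
      using assms(3) by (auto simp: fibre_def dual_def)
  qed (use m zer_addB_core assms(2,4) in \<open>auto simp: pairing_def\<close>)
  ultimately have "core_prj VA VB WA C \<Phi> = \<kappa>"
    using kappa_base(3)[OF assms(3)] by (auto simp: core_prj_def Let_def intro: prod_eqI)
  moreover have "\<Phi> \<in> tot (dual VA)"
    using assms(1) by (simp add: fibre_def)
  ultimately show ?thesis
    by (simp add: fibre_def dual_over_core_dual_def)
qed

lemma fibre_PD:
  assumes "\<Phi> \<in> fibre P \<kappa>"
  shows "\<Phi> \<in> fibre (dual VA) (fst \<Phi>)" "fst \<Phi> \<in> fibre WA (fst \<kappa>)"
proof -
  have "\<Phi> \<in> tot (dual VA)" and k: "core_prj VA VB WA C \<Phi> = \<kappa>"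
    using assms by (auto simp: fibre_def dual_over_core_dual_def)
  then show t: "\<Phi> \<in> fibre (dual VA) (fst \<Phi>)"
    using dual_fibre_of_tot by blast
  show "fst \<Phi> \<in> fibre WA (fst \<kappa>)"
    using base_of_dual_fibre[OF t] k bas_A by (auto simp: core_prj_def Let_def fibre_def)
qed

lemma pairing_translate:
  assumes "\<Phi> \<in> fibre P \<kappa>" "c \<in> core_fibre (fst \<kappa>)" "d \<in> fibre VA (fst \<Phi>)"
  shows "pairing \<Phi> (translate d c) = pairing \<Phi> d + pairing \<kappa> c"
proof -
  note \<Phi> = fibre_PD[OF assms(1)]
  let ?z = "zer VA (fst \<Phi>)"
  have "core_prj VA VB WA C \<Phi> = \<kappa>"
    using assms(1) by (auto simp: fibre_def dual_over_core_dual_def)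
  then have "pairing \<kappa> c = (\<lambda>c\<in>fibre C (fst \<kappa>). pairing \<Phi> (?z \<oplus>\<^bsub>VB\<^esub> c)) c"
    by (auto simp: core_prj_def Let_def pairing_def)
  also have "\<dots> = pairing \<Phi> (?z \<oplus>\<^bsub>VB\<^esub> c)"
    using assms(2) fibre_core[OF core_fibreD(1)[OF assms(2)]] by simp
  finally have "pairing \<kappa> c = pairing \<Phi> (c \<oplus>\<^bsub>VB\<^esub> ?z)"
    using B.add_comm[OF zerA_over_B[OF \<Phi>(2)] core_fibreD(4)[OF assms(2)]] by simp
  then show ?thesis
    using translate_A[OF assms(3,2) \<Phi>(2)] pairing_add[OF \<Phi>(1) assms(3) core_plus_zer(1)[OF assms(2) \<Phi>(2)]]
    by simp
qed

lemma linear_section_zer: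
  assumes "bundle_morphism WB VA \<zeta> Z" "m \<in> bas WB"
  shows "\<zeta> (zer WB m) = zer VA (Z m)"
  using morphism_zer[OF WB.fibrewise_vector_space_axioms A.fibrewise_vector_space_axioms assms] .

text \<open>
  A linear section splits the fibre of \<open>D\<close> over \<open>Z m\<close> into its own values and the core: every element
  is \<open>translate (\<zeta> b) c\<close> for unique \<open>b\<close> and \<open>c\<close>. The covector sends it to \<open>\<kappa> c\<close>.
\<close>

lemma vanishing_covector:
  assumes \<zeta>: "bundle_morphism WB VA \<zeta> Z" and over_b: "\<And>b. b \<in> tot WB \<Longrightarrow> \<zeta> b \<in> fibre VB b"
    and Z: "Z m \<in> fibre WA m" and \<kappa>: "\<kappa> \<in> fibre (dual C) m"
  shows "\<exists>\<Phi>\<in>fibre P \<kappa>. fst \<Phi> = Z m \<and> (\<forall>b\<in>fibre WB m. pairing \<Phi> (\<zeta> b) = 0)"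
proof -
  note m = kappa_base[OF \<kappa>]
  have \<zeta>A: "\<zeta> b \<in> fibre VA (Z m)" and \<zeta>B: "\<zeta> b \<in> fibre VB b" if "b \<in> fibre WB m" for b
    using \<zeta> m(2) that over_b by (auto simp: bundle_morphism_def fibre_def)
  have \<zeta>_add: "\<zeta> (b \<oplus>\<^bsub>WB\<^esub> b') = \<zeta> b \<oplus>\<^bsub>VA\<^esub> \<zeta> b'" if "b \<in> fibre WB m" "b' \<in> fibre WB m" for b b'
    using \<zeta> m(2) that by (simp add: bundle_morphism_def)
  have \<zeta>_smult: "\<zeta> (r \<odot>\<^bsub>WB\<^esub> b) = r \<odot>\<^bsub>VA\<^esub> \<zeta> b" if "b \<in> fibre WB m" for r b
    using \<zeta> m(2) that by (simp add: bundle_morphism_def)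
  define R where "R d r \<longleftrightarrow>
    (\<exists>b\<in>fibre WB m. \<exists>c\<in>core_fibre m. d = translate (\<zeta> b) c \<and> r = pairing \<kappa> c)" for d r
  have "\<exists>\<Phi>\<in>fibre (dual VA) (Z m). \<forall>d r. d \<in> fibre VA (Z m) \<longrightarrow> R d r \<longrightarrow> pairing \<Phi> d = r"
  proof (rule A.covector_of_linear_relation)
    show "Z m \<in> bas VA"
      using Z bas_A by (simp add: fibre_def)
  next
    fix d assume d: "d \<in> fibre VA (Z m)"
    let ?b = "prj VB d"
    note dB = in_other_fibre[OF d]
    have b: "?b \<in> fibre WB m"
      using same_base[OF d dB Z] .
    obtain c where "c \<in> core_fibre m" "d = translate (\<zeta> ?b) c"
      using translate_transitive[OF \<zeta>A[OF b] d \<zeta>B[OF b] dB Z] .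
    then show "\<exists>r. R d r"
      unfolding R_def using b by blast
  next
    fix d r s assume "R d r" "R d s"
    then obtain b c b' c' where 1: "b \<in> fibre WB m" "c \<in> core_fibre m" "d = translate (\<zeta> b) c" "r = pairing \<kappa> c"
      and 2: "b' \<in> fibre WB m" "c' \<in> core_fibre m" "d = translate (\<zeta> b') c'" "s = pairing \<kappa> c'"
      unfolding R_def by blast
    have "d \<in> fibre VB b"
      using translate_over_B[OF \<zeta>A \<zeta>B _ Z] 1 by simp
    moreover have "d \<in> fibre VB b'"
      unfolding 2(3) using translate_over_B[OF \<zeta>A \<zeta>B _ Z] 2(1,2) by blast
    ultimately have "b = b'"
      by (simp add: fibre_def)
    then show "r = s"
      using translate_free[OF \<zeta>A[OF 1(1)] 1(2) 2(2) Z] 1 2 by simp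
  next
    fix d e r s assume "R d r" "R e s"
    then obtain b c b' c' where 1: "b \<in> fibre WB m" "c \<in> core_fibre m" "d = translate (\<zeta> b) c" "r = pairing \<kappa> c"
      and 2: "b' \<in> fibre WB m" "c' \<in> core_fibre m" "e = translate (\<zeta> b') c'" "s = pairing \<kappa> c'"
      unfolding R_def by blast
    have "d \<oplus>\<^bsub>VA\<^esub> e = translate (\<zeta> (b \<oplus>\<^bsub>WB\<^esub> b')) (c \<oplus>\<^bsub>VA\<^esub> c')"
      using translate_addA[OF \<zeta>A[OF 1(1)] \<zeta>A[OF 2(1)] 1(2) 2(2) Z] \<zeta>_add[OF 1(1) 2(1)] 1 2 by simp
    moreover have "r + s = pairing \<kappa> (c \<oplus>\<^bsub>VA\<^esub> c')"
      using kappa_add[OF \<kappa> 1(2) 2(2)] 1 2 by simp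
    ultimately show "R (d \<oplus>\<^bsub>VA\<^esub> e) (r + s)"
      unfolding R_def using WB.add_closed[OF 1(1) 2(1)] core_addA[OF 1(2) 2(2)] by blast
  next
    fix d r k assume "R d r"
    then obtain b c where 1: "b \<in> fibre WB m" "c \<in> core_fibre m" "d = translate (\<zeta> b) c" "r = pairing \<kappa> c"
      unfolding R_def by blast
    have "k \<odot>\<^bsub>VA\<^esub> d = translate (\<zeta> (k \<odot>\<^bsub>WB\<^esub> b)) (k \<odot>\<^bsub>VA\<^esub> c)"
      using translate_smultA[OF \<zeta>A[OF 1(1)] 1(2) Z] \<zeta>_smult[OF 1(1)] 1 by simp
    moreover have "k * r = pairing \<kappa> (k \<odot>\<^bsub>VA\<^esub> c)"
      using kappa_smult[OF \<kappa> 1(2)] 1 by simp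
    ultimately show "R (k \<odot>\<^bsub>VA\<^esub> d) (k * r)"
      unfolding R_def using WB.smult_closed[OF 1(1)] core_smultA[OF 1(2)] by blast
  qed
  then obtain \<Phi> where \<Phi>: "\<Phi> \<in> fibre (dual VA) (Z m)"
      "\<And>d r. d \<in> fibre VA (Z m) \<Longrightarrow> R d r \<Longrightarrow> pairing \<Phi> d = r"
    by blast
  have \<Phi>_eq: "pairing \<Phi> (translate (\<zeta> b) c) = pairing \<kappa> c" if "b \<in> fibre WB m" "c \<in> core_fibre m" for b c
    using \<Phi>(2)[OF translate_over_A[OF \<zeta>A[OF that(1)] that(2) Z]] that unfolding R_def by blast
  have "pairing \<Phi> (\<zeta> b) = 0" if "b \<in> fibre WB m" for b
    using \<Phi>_eq[OF that core_zer[OF m(1)]] translate_zer[OF \<zeta>A[OF that] Z] kappa_zer[OF \<kappa>] by simp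
  moreover have "\<Phi> \<in> fibre P \<kappa>"
    using fibre_PI[OF \<Phi>(1) Z \<kappa>] \<Phi>_eq[OF WB.zer_closed[OF m(2)]] linear_section_zer[OF \<zeta> m(2)] by simp
  ultimately show ?thesis
    using fst_of_dual_fibre[OF \<Phi>(1)] by blast
qed

lemma translate_addB:
  assumes "d \<in> fibre VA a" "d' \<in> fibre VA a'" "d \<in> fibre VB b" "d' \<in> fibre VB b"
    and "c \<in> core_fibre m" "c' \<in> core_fibre m" "a \<in> fibre WA m" "a' \<in> fibre WA m"
  shows "translate d c \<oplus>\<^bsub>VB\<^esub> translate d' c' = translate (d \<oplus>\<^bsub>VB\<^esub> d') (c \<oplus>\<^bsub>VA\<^esub> c')"
proof -
  have b: "b \<in> fibre WB m"
    using same_base assms(1,3,7) .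
  have "d \<oplus>\<^bsub>VB\<^esub> d' \<in> fibre VA (a \<oplus>\<^bsub>WA\<^esub> a')" "d \<oplus>\<^bsub>VB\<^esub> d' \<in> fibre VB b"
    using swap.addA_over_B B.add_closed assms by blast+
  then show ?thesis
    using swap.translate_addA[OF assms(3,4), of c m c'] b assms(5,6)
      translate_swap[OF assms(1,3,5,7)] translate_swap[OF assms(2,4,6,8)]
      translate_swap[OF _ _ core_addA[OF assms(5,6)] WA.add_closed[OF assms(7,8)]]
      core_add_eq[OF assms(5,6)] by (simp add: core_fibre_swap)
qed

lemma translate_smultB:
  assumes "d \<in> fibre VA a" "d \<in> fibre VB b" "c \<in> core_fibre m" "a \<in> fibre WA m"
  shows "r \<odot>\<^bsub>VB\<^esub> translate d c = translate (r \<odot>\<^bsub>VB\<^esub> d) (r \<odot>\<^bsub>VA\<^esub> c)"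
proof -
  have b: "b \<in> fibre WB m"
    using same_base assms(1,2,4) .
  have "r \<odot>\<^bsub>VB\<^esub> d \<in> fibre VA (r \<odot>\<^bsub>WA\<^esub> a)" "r \<odot>\<^bsub>VB\<^esub> d \<in> fibre VB b"
    using swap.smultA_over_B B.smult_closed assms by blast+
  then show ?thesis
    using swap.translate_smultA[OF assms(2), of c m r] b assms(3)
      translate_swap[OF assms] translate_swap[OF _ _ core_smultA[OF assms(3)] WA.smult_closed[OF assms(4)]]
      core_smult_eq[OF assms(3)] by (simp add: core_fibre_swap)
qed

text \<open>
  Any \<open>d\<close> and \<open>d'\<close> over \<open>(a, b)\<close> and \<open>(a', b)\<close> have a sum that differs from \<open>e\<close> by a core element, and
  one of them can absorb it.
\<close>

lemma decompose_sum:
  assumes "a \<in> fibre WA m" "a' \<in> fibre WA m" "e \<in> fibre VA (a \<oplus>\<^bsub>WA\<^esub> a')" "e \<in> fibre VB b"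
  obtains d d' where "d \<in> fibre VA a" "d' \<in> fibre VA a'" "d \<in> fibre VB b" "d' \<in> fibre VB b"
    "e = d \<oplus>\<^bsub>VB\<^esub> d'"
proof -
  note s = WA.add_closed[OF assms(1,2)]
  note b = same_base[OF assms(3,4) s]
  obtain d d' where d: "d \<in> fibre VA a" "d \<in> fibre VB b" and d': "d' \<in> fibre VA a'" "d' \<in> fibre VB b"
    using surj[OF assms(1) b] surj[OF assms(2) b] by blast
  note sA = swap.addA_over_B[OF d(2) d'(2) d(1) d'(1)] and sB = B.add_closed[OF d(2) d'(2)]
  obtain c where c: "c \<in> core_fibre m" "e = translate (d \<oplus>\<^bsub>VB\<^esub> d') c"
    using translate_transitive[OF sA assms(3) sB assms(4) s] .
  let ?z = "zer VA (zer WA m)"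
  note z = core_zer[OF WA.base_of_fibre[OF assms(1)]]
  have "translate d c \<oplus>\<^bsub>VB\<^esub> d' = translate d c \<oplus>\<^bsub>VB\<^esub> translate d' ?z"
    using translate_zer[OF d'(1) assms(2)] by simp
  also have "\<dots> = translate (d \<oplus>\<^bsub>VB\<^esub> d') (c \<oplus>\<^bsub>VA\<^esub> ?z)"
    using translate_addB[OF d(1) d'(1) d(2) d'(2) c(1) z assms(1,2)] .
  also have "c \<oplus>\<^bsub>VA\<^esub> ?z = c"
    using A.add_zer[OF core_fibreD(3)[OF c(1)]] by simp
  finally show ?thesis
    using that[OF translate_over_A[OF d(1) c(1) assms(1)] d'(1) translate_over_B[OF d c(1) assms(1)] d'(2)] c
    by simp
qed

lemma fibre_P_iff:
  "\<Phi> \<in> fibre P \<kappa> \<longleftrightarrow> \<Phi> \<in> fibre (dual VA) (fst \<Phi>) \<and> core_prj VA VB WA C \<Phi> = \<kappa>"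
  unfolding fibre_def[of P] dual_fibre_of_tot[symmetric] by (simp add: dual_over_core_dual_def)

text \<open>
  Two decompositions of \<open>e\<close> differ by \<open>d \<mapsto> translate d c\<close> and \<open>d' \<mapsto> translate d' c'\<close> with \<open>c + c' = 0\<close>.
  The two values then change by \<open>\<kappa> c\<close> and \<open>\<kappa> c'\<close>, so their sum stays the same. This is where it matters
  that both covectors lie over the same \<open>\<kappa>\<close>.
\<close>

lemma sum_covector:
  assumes \<kappa>: "\<kappa> \<in> fibre (dual C) m" and \<Phi>: "\<Phi> \<in> fibre P \<kappa>" "\<Phi>' \<in> fibre P \<kappa>"
  shows "\<exists>\<Omega>\<in>fibre P \<kappa>. fst \<Omega> = fst \<Phi> \<oplus>\<^bsub>WA\<^esub> fst \<Phi>' \<and>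
    (\<forall>b d d'. d \<in> fibre VA (fst \<Phi>) \<longrightarrow> d' \<in> fibre VA (fst \<Phi>') \<longrightarrow> d \<in> fibre VB b \<longrightarrow> d' \<in> fibre VB b \<longrightarrow>
      pairing \<Omega> (d \<oplus>\<^bsub>VB\<^esub> d') = pairing \<Phi> d + pairing \<Phi>' d')"
proof -
  define a a' where "a = fst \<Phi>" and "a' = fst \<Phi>'"
  note m = kappa_base[OF \<kappa>]
  have a: "a \<in> fibre WA m" "a' \<in> fibre WA m"
    and dual: "\<Phi> \<in> fibre (dual VA) a" "\<Phi>' \<in> fibre (dual VA) a'"
    using fibre_PD[OF \<Phi>(1)] fibre_PD[OF \<Phi>(2)] m(3) by (simp_all add: a_def a'_def)
  note s = WA.add_closed[OF a]
  have shift: "pairing \<Phi> (translate d c) = pairing \<Phi> d + pairing \<kappa> c" if "d \<in> fibre VA a" "c \<in> core_fibre m" for d c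
    using pairing_translate[OF \<Phi>(1)] that m(3) by (simp add: a_def)
  have shift': "pairing \<Phi>' (translate d c) = pairing \<Phi>' d + pairing \<kappa> c" if "d \<in> fibre VA a'" "c \<in> core_fibre m" for d c
    using pairing_translate[OF \<Phi>(2)] that m(3) by (simp add: a'_def)
  define R where "R e r \<longleftrightarrow> (\<exists>b d d'. d \<in> fibre VA a \<and> d' \<in> fibre VA a' \<and> d \<in> fibre VB b \<and> d' \<in> fibre VB b \<and>
    e = d \<oplus>\<^bsub>VB\<^esub> d' \<and> r = pairing \<Phi> d + pairing \<Phi>' d')" for e r
  have "\<exists>\<Omega>\<in>fibre (dual VA) (a \<oplus>\<^bsub>WA\<^esub> a'). \<forall>e r. e \<in> fibre VA (a \<oplus>\<^bsub>WA\<^esub> a') \<longrightarrow> R e r \<longrightarrow> pairing \<Omega> e = r"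
  proof (rule A.covector_of_linear_relation)
    show "a \<oplus>\<^bsub>WA\<^esub> a' \<in> bas VA"
      using s bas_A by (simp add: fibre_def)
  next
    fix e assume e: "e \<in> fibre VA (a \<oplus>\<^bsub>WA\<^esub> a')"
    show "\<exists>r. R e r"
      using decompose_sum[OF a e in_other_fibre[OF e]] unfolding R_def by metis
  next
    fix e r r2 assume "R e r" "R e r2"
    then obtain b d d' b2 d2 d2'
      where 1: "d \<in> fibre VA a" "d' \<in> fibre VA a'" "d \<in> fibre VB b" "d' \<in> fibre VB b"
          "e = d \<oplus>\<^bsub>VB\<^esub> d'" "r = pairing \<Phi> d + pairing \<Phi>' d'"
        and 2: "d2 \<in> fibre VA a" "d2' \<in> fibre VA a'" "d2 \<in> fibre VB b2" "d2' \<in> fibre VB b2"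
          "e = d2 \<oplus>\<^bsub>VB\<^esub> d2'" "r2 = pairing \<Phi> d2 + pairing \<Phi>' d2'"
      unfolding R_def by blast
    have eB: "e \<in> fibre VB b" and "e \<in> fibre VB b2"
      using B.add_closed[OF 1(3,4)] B.add_closed[OF 2(3,4)] 1(5) 2(5) by simp_all
    then have b2: "b2 = b"
      by (simp add: fibre_def)
    have eA: "e \<in> fibre VA (a \<oplus>\<^bsub>WA\<^esub> a')"
      unfolding 1(5) using swap.addA_over_B[OF 1(3,4,1,2)] .
    obtain c where c: "c \<in> core_fibre m" "d2 = translate d c"
      using translate_transitive[OF 1(1) 2(1) 1(3) 2(3)[unfolded b2] a(1)] .
    obtain c' where c': "c' \<in> core_fibre m" "d2' = translate d' c'"
      using translate_transitive[OF 1(2) 2(2) 1(4) 2(4)[unfolded b2] a(2)] .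
    have "translate e (c \<oplus>\<^bsub>VA\<^esub> c') = e"
      using translate_addB[OF 1(1-4) c(1) c'(1) a] c c' 1(5) 2(5) by simp
    then have "c \<oplus>\<^bsub>VA\<^esub> c' = zer VA (zer WA m)"
      using translate_free[OF eA core_addA[OF c(1) c'(1)] core_zer[OF m(1)] s] translate_zer[OF eA s] by simp
    then have "pairing \<kappa> c + pairing \<kappa> c' = 0"
      using kappa_add[OF \<kappa> c(1) c'(1)] kappa_zer[OF \<kappa>] by simp
    then show "r = r2"
      using shift[OF 1(1) c(1)] shift'[OF 1(2) c'(1)] c c' 1(6) 2(6) by simp
  next
    fix e e2 r r2 assume "R e r" "R e2 r2"
    then obtain b d d' b2 d2 d2'
      where 1: "d \<in> fibre VA a" "d' \<in> fibre VA a'" "d \<in> fibre VB b" "d' \<in> fibre VB b"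
          "e = d \<oplus>\<^bsub>VB\<^esub> d'" "r = pairing \<Phi> d + pairing \<Phi>' d'"
        and 2: "d2 \<in> fibre VA a" "d2' \<in> fibre VA a'" "d2 \<in> fibre VB b2" "d2' \<in> fibre VB b2"
          "e2 = d2 \<oplus>\<^bsub>VB\<^esub> d2'" "r2 = pairing \<Phi> d2 + pairing \<Phi>' d2'"
      unfolding R_def by blast
    have "e \<oplus>\<^bsub>VA\<^esub> e2 = (d \<oplus>\<^bsub>VA\<^esub> d2) \<oplus>\<^bsub>VB\<^esub> (d' \<oplus>\<^bsub>VA\<^esub> d2')"
      using interchange[OF 1(1) 2(1) 1(2) 2(2) 1(3,4) 2(3,4)] 1(5) 2(5) by simp
    moreover have "r + r2 = pairing \<Phi> (d \<oplus>\<^bsub>VA\<^esub> d2) + pairing \<Phi>' (d' \<oplus>\<^bsub>VA\<^esub> d2')"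
      using pairing_add[OF dual(1) 1(1) 2(1)] pairing_add[OF dual(2) 1(2) 2(2)] 1(6) 2(6) by simp
    ultimately show "R (e \<oplus>\<^bsub>VA\<^esub> e2) (r + r2)"
      unfolding R_def
      using A.add_closed[OF 1(1) 2(1)] A.add_closed[OF 1(2) 2(2)]
        addA_over_B[OF 1(1) 2(1) 1(3) 2(3)] addA_over_B[OF 1(2) 2(2) 1(4) 2(4)] by blast
  next
    fix e r k assume "R e r"
    then obtain b d d'
      where 1: "d \<in> fibre VA a" "d' \<in> fibre VA a'" "d \<in> fibre VB b" "d' \<in> fibre VB b"
          "e = d \<oplus>\<^bsub>VB\<^esub> d'" "r = pairing \<Phi> d + pairing \<Phi>' d'"
      unfolding R_def by blast
    have "k \<odot>\<^bsub>VA\<^esub> e = k \<odot>\<^bsub>VA\<^esub> d \<oplus>\<^bsub>VB\<^esub> k \<odot>\<^bsub>VA\<^esub> d'"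
      using smultA_addB[OF 1(1-4)] 1(5) by simp
    moreover have "k * r = pairing \<Phi> (k \<odot>\<^bsub>VA\<^esub> d) + pairing \<Phi>' (k \<odot>\<^bsub>VA\<^esub> d')"
      using pairing_smult[OF dual(1) 1(1)] pairing_smult[OF dual(2) 1(2)] 1(6) by (simp add: distrib_left)
    ultimately show "R (k \<odot>\<^bsub>VA\<^esub> e) (k * r)"
      unfolding R_def
      using A.smult_closed[OF 1(1)] A.smult_closed[OF 1(2)]
        smultA_over_B[OF 1(1,3)] smultA_over_B[OF 1(2,4)] by blast
  qed
  then obtain \<Omega> where \<Omega>: "\<Omega> \<in> fibre (dual VA) (a \<oplus>\<^bsub>WA\<^esub> a')"
      "\<And>e r. e \<in> fibre VA (a \<oplus>\<^bsub>WA\<^esub> a') \<Longrightarrow> R e r \<Longrightarrow> pairing \<Omega> e = r"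
    by blast
  have \<Omega>_eq: "pairing \<Omega> (d \<oplus>\<^bsub>VB\<^esub> d') = pairing \<Phi> d + pairing \<Phi>' d'"
    if "d \<in> fibre VA a" "d' \<in> fibre VA a'" "d \<in> fibre VB b" "d' \<in> fibre VB b" for b d d'
    using \<Omega>(2)[OF swap.addA_over_B[OF that(3,4,1,2)]] that unfolding R_def by blast
  have "pairing \<Omega> (translate (zer VA (a \<oplus>\<^bsub>WA\<^esub> a')) c) = pairing \<kappa> c" if c: "c \<in> core_fibre m" for c
  proof -
    note z = zerA_closed[OF a(1)] zerA_closed[OF a(2)] zerA_over_B[OF a(1)] zerA_over_B[OF a(2)]
    have "translate (zer VA (a \<oplus>\<^bsub>WA\<^esub> a')) c = translate (zer VA a) c \<oplus>\<^bsub>VB\<^esub> zer VA a'"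
      using translate_addB[OF z c core_zer[OF m(1)] a] translate_zer[OF z(2) a(2)]
        A.add_zer[OF core_fibreD(3)[OF c]] zerA_add[OF a] by simp
    then have "pairing \<Omega> (translate (zer VA (a \<oplus>\<^bsub>WA\<^esub> a')) c) =
        pairing \<Phi> (zer VA a) + pairing \<kappa> c + pairing \<Phi>' (zer VA a')"
      using \<Omega>_eq[OF translate_over_A[OF z(1) c a(1)] z(2) translate_over_B[OF z(1,3) c a(1)] z(4)]
        shift[OF z(1) c] by simp
    also have "\<dots> = pairing \<kappa> c"
      using pairing_smult[OF dual(1) z(1), of 0] pairing_smult[OF dual(2) z(2), of 0]
        A.zero_smult[OF z(1)] A.zero_smult[OF z(2)] by simp
    finally show ?thesis .
  qed
  then have "\<Omega> \<in> fibre P \<kappa>"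
    using fibre_PI[OF \<Omega>(1) s \<kappa>] by blast
  then show ?thesis
    using \<Omega>_eq fst_of_dual_fibre[OF \<Omega>(1)] unfolding a_def a'_def by blast
qed

lemma add_P:
  assumes \<kappa>: "\<kappa> \<in> fibre (dual C) m" and \<Phi>: "\<Phi> \<in> fibre P \<kappa>" "\<Phi>' \<in> fibre P \<kappa>"
  shows "\<Phi> \<oplus>\<^bsub>P\<^esub> \<Phi>' \<in> fibre P \<kappa>"
    and "fst (\<Phi> \<oplus>\<^bsub>P\<^esub> \<Phi>') = fst \<Phi> \<oplus>\<^bsub>WA\<^esub> fst \<Phi>'"
    and "d \<in> fibre VA (fst \<Phi>) \<Longrightarrow> d' \<in> fibre VA (fst \<Phi>') \<Longrightarrow> d \<in> fibre VB b \<Longrightarrow> d' \<in> fibre VB b \<Longrightarrow>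
      pairing (\<Phi> \<oplus>\<^bsub>P\<^esub> \<Phi>') (d \<oplus>\<^bsub>VB\<^esub> d') = pairing \<Phi> d + pairing \<Phi>' d'"
proof -
  let ?s = "fst \<Phi> \<oplus>\<^bsub>WA\<^esub> fst \<Phi>'"
  define Q where "Q \<Omega> \<longleftrightarrow> \<Omega> \<in> fibre (dual VA) ?s \<and> core_prj VA VB WA C \<Omega> = core_prj VA VB WA C \<Phi> \<and>
    (\<forall>d\<in>fibre VA (fst \<Phi>). \<forall>d'\<in>fibre VA (fst \<Phi>'). prj VB d = prj VB d' \<longrightarrow>
      pairing \<Omega> (d \<oplus>\<^bsub>VB\<^esub> d') = pairing \<Phi> d + pairing \<Phi>' d')" for \<Omega>
  obtain \<Omega> where \<Omega>: "\<Omega> \<in> fibre P \<kappa>" "fst \<Omega> = ?s"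
    "\<And>b d d'. d \<in> fibre VA (fst \<Phi>) \<Longrightarrow> d' \<in> fibre VA (fst \<Phi>') \<Longrightarrow> d \<in> fibre VB b \<Longrightarrow> d' \<in> fibre VB b \<Longrightarrow>
      pairing \<Omega> (d \<oplus>\<^bsub>VB\<^esub> d') = pairing \<Phi> d + pairing \<Phi>' d'"
    using sum_covector[OF assms] by blast
  have Q\<Omega>: "Q \<Omega>"
    unfolding Q_def
  proof (intro conjI ballI impI)
    fix d d' assume d: "d \<in> fibre VA (fst \<Phi>)" "d' \<in> fibre VA (fst \<Phi>')" "prj VB d = prj VB d'"
    then show "pairing \<Omega> (d \<oplus>\<^bsub>VB\<^esub> d') = pairing \<Phi> d + pairing \<Phi>' d'"
      using \<Omega>(3)[OF d(1,2) in_other_fibre[OF d(1)]] in_other_fibre[OF d(2)] by simp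
  qed (use \<Omega>(1,2) \<Phi>(1) fibre_P_iff in auto)
  have "\<Phi> \<oplus>\<^bsub>P\<^esub> \<Phi>' = (THE \<Omega>. Q \<Omega>)"
    by (simp add: dual_over_core_dual_def Q_def)
  also have "\<dots> = \<Omega>"
  proof (rule the_equality[of Q, OF Q\<Omega>])
    fix \<Omega>' assume Q': "Q \<Omega>'"
    show "\<Omega>' = \<Omega>"
    proof (rule dual_eqI[of _ VA ?s])
      fix e assume e: "e \<in> fibre VA ?s"
      obtain d d' where d: "d \<in> fibre VA (fst \<Phi>)" "d' \<in> fibre VA (fst \<Phi>')"
          "d \<in> fibre VB (prj VB e)" "d' \<in> fibre VB (prj VB e)" "e = d \<oplus>\<^bsub>VB\<^esub> d'"
        using decompose_sum[OF fibre_PD(2)[OF \<Phi>(1)] fibre_PD(2)[OF \<Phi>(2)] e in_other_fibre[OF e]] .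
      then have "prj VB d = prj VB d'"
        by (simp add: fibre_def)
      then show "pairing \<Omega>' e = pairing \<Omega> e"
        using Q' Q\<Omega> d unfolding Q_def by simp
    qed (use Q' Q\<Omega> in \<open>auto simp: Q_def\<close>)
  qed
  finally have eq: "\<Phi> \<oplus>\<^bsub>P\<^esub> \<Phi>' = \<Omega>" .
  show "\<Phi> \<oplus>\<^bsub>P\<^esub> \<Phi>' \<in> fibre P \<kappa>" "fst (\<Phi> \<oplus>\<^bsub>P\<^esub> \<Phi>') = ?s"
    unfolding eq by fact+
  show "pairing (\<Phi> \<oplus>\<^bsub>P\<^esub> \<Phi>') (d \<oplus>\<^bsub>VB\<^esub> d') = pairing \<Phi> d + pairing \<Phi>' d'"
    if "d \<in> fibre VA (fst \<Phi>)" "d' \<in> fibre VA (fst \<Phi>')" "d \<in> fibre VB b" "d' \<in> fibre VB b"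
    unfolding eq using \<Omega>(3) that .
qed

text \<open>
  The core element is what makes this true for \<open>r = 0\<close> as well, when \<open>r \<odot> d\<close> is only a zero of \<open>D \<rightarrow> B\<close>.
\<close>

lemma decompose_multiple:
  assumes "a \<in> fibre WA m" "e \<in> fibre VA (r \<odot>\<^bsub>WA\<^esub> a)"
  obtains d c where "d \<in> fibre VA a" "d \<in> fibre VB (prj VB e)" "c \<in> core_fibre m"
    "e = translate (r \<odot>\<^bsub>VB\<^esub> d) c"
proof -
  note eB = in_other_fibre[OF assms(2)] and ra = WA.smult_closed[OF assms(1)]
  obtain d where d: "d \<in> fibre VA a" "d \<in> fibre VB (prj VB e)"
    using surj[OF assms(1) same_base[OF assms(2) eB ra]] by blast
  show ?thesis
    using translate_transitive[OF swap.smultA_over_B[OF d(2,1)] assms(2) B.smult_closed[OF d(2)] eB ra]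
      that[OF d] by blast
qed

text \<open>
  The value at \<open>translate (t \<odot> d) c\<close> is \<open>t * \<Phi> d + \<kappa> c\<close>. Replacing \<open>d\<close> by \<open>translate d c'\<close> replaces \<open>c\<close> by
  \<open>c - t \<odot> c'\<close>, and the two changes cancel.
\<close>

lemma multiple_covector:
  assumes \<kappa>: "\<kappa> \<in> fibre (dual C) m" and \<Phi>: "\<Phi> \<in> fibre P \<kappa>"
  shows "\<exists>\<Omega>\<in>fibre P \<kappa>. fst \<Omega> = t \<odot>\<^bsub>WA\<^esub> fst \<Phi> \<and>
    (\<forall>d\<in>fibre VA (fst \<Phi>). pairing \<Omega> (t \<odot>\<^bsub>VB\<^esub> d) = t * pairing \<Phi> d)"
proof -
  define a where "a = fst \<Phi>"
  note m = kappa_base[OF \<kappa>]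
  have a: "a \<in> fibre WA m" and dual: "\<Phi> \<in> fibre (dual VA) a"
    using fibre_PD[OF \<Phi>] m(3) by (simp_all add: a_def)
  note ta = WA.smult_closed[OF a, of t]
  have shift: "pairing \<Phi> (translate d c) = pairing \<Phi> d + pairing \<kappa> c" if "d \<in> fibre VA a" "c \<in> core_fibre m" for d c
    using pairing_translate[OF \<Phi>] that m(3) by (simp add: a_def)
  have tA: "t \<odot>\<^bsub>VB\<^esub> d \<in> fibre VA (t \<odot>\<^bsub>WA\<^esub> a)" if "d \<in> fibre VA a" for d
    using swap.smultA_over_B[OF in_other_fibre[OF that] that] .
  define R where "R e r \<longleftrightarrow> (\<exists>d\<in>fibre VA a. \<exists>c\<in>core_fibre m.
    e = translate (t \<odot>\<^bsub>VB\<^esub> d) c \<and> r = t * pairing \<Phi> d + pairing \<kappa> c)" for e r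
  have "\<exists>\<Omega>\<in>fibre (dual VA) (t \<odot>\<^bsub>WA\<^esub> a). \<forall>e r. e \<in> fibre VA (t \<odot>\<^bsub>WA\<^esub> a) \<longrightarrow> R e r \<longrightarrow> pairing \<Omega> e = r"
  proof (rule A.covector_of_linear_relation)
    show "t \<odot>\<^bsub>WA\<^esub> a \<in> bas VA"
      using ta bas_A by (simp add: fibre_def)
  next
    fix e assume e: "e \<in> fibre VA (t \<odot>\<^bsub>WA\<^esub> a)"
    show "\<exists>r. R e r"
      using decompose_multiple[OF a e] unfolding R_def by metis
  next
    fix e r r2 assume "R e r" "R e r2"
    then obtain d c d2 c2
      where 1: "d \<in> fibre VA a" "c \<in> core_fibre m"
          "e = translate (t \<odot>\<^bsub>VB\<^esub> d) c" "r = t * pairing \<Phi> d + pairing \<kappa> c"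
        and 2: "d2 \<in> fibre VA a" "c2 \<in> core_fibre m"
          "e = translate (t \<odot>\<^bsub>VB\<^esub> d2) c2" "r2 = t * pairing \<Phi> d2 + pairing \<kappa> c2"
      unfolding R_def by blast
    let ?b = "prj VB d"
    note dB = in_other_fibre[OF 1(1)] and d2B = in_other_fibre[OF 2(1)]
    have "e \<in> fibre VB ?b"
      unfolding 1(3) using translate_over_B[OF tA[OF 1(1)] B.smult_closed[OF dB] 1(2) ta] .
    moreover have "e \<in> fibre VB (prj VB d2)"
      unfolding 2(3) using translate_over_B[OF tA[OF 2(1)] B.smult_closed[OF d2B] 2(2) ta] .
    ultimately have "prj VB d2 = ?b"
      by (simp add: fibre_def)
    then have d2B: "d2 \<in> fibre VB ?b"
      using d2B by simp
    obtain c' where c': "c' \<in> core_fibre m" "d2 = translate d c'"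
      using translate_transitive[OF 1(1) 2(1) dB d2B a] .
    have "e = translate (t \<odot>\<^bsub>VB\<^esub> d) (t \<odot>\<^bsub>VA\<^esub> c' \<oplus>\<^bsub>VA\<^esub> c2)"
      unfolding 2(3) c'(2) translate_smultB[OF 1(1) dB c'(1) a]
      using translate_translate[OF tA[OF 1(1)] core_smultA[OF c'(1)] 2(2) ta] .
    then have "c = t \<odot>\<^bsub>VA\<^esub> c' \<oplus>\<^bsub>VA\<^esub> c2"
      using translate_free[OF tA[OF 1(1)] 1(2) core_addA[OF core_smultA[OF c'(1)] 2(2)] ta] 1(3) by simp
    then have "pairing \<kappa> c = t * pairing \<kappa> c' + pairing \<kappa> c2"
      using kappa_add[OF \<kappa> core_smultA[OF c'(1)] 2(2)] kappa_smult[OF \<kappa> c'(1)] by simp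
    then show "r = r2"
      using shift[OF 1(1) c'(1)] c'(2) 1(4) 2(4) by (simp add: distrib_left)
  next
    fix e e2 r r2 assume "R e r" "R e2 r2"
    then obtain d c d2 c2
      where 1: "d \<in> fibre VA a" "c \<in> core_fibre m"
          "e = translate (t \<odot>\<^bsub>VB\<^esub> d) c" "r = t * pairing \<Phi> d + pairing \<kappa> c"
        and 2: "d2 \<in> fibre VA a" "c2 \<in> core_fibre m"
          "e2 = translate (t \<odot>\<^bsub>VB\<^esub> d2) c2" "r2 = t * pairing \<Phi> d2 + pairing \<kappa> c2"
      unfolding R_def by blast
    have "e \<oplus>\<^bsub>VA\<^esub> e2 = translate (t \<odot>\<^bsub>VB\<^esub> (d \<oplus>\<^bsub>VA\<^esub> d2)) (c \<oplus>\<^bsub>VA\<^esub> c2)"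
      using translate_addA[OF tA[OF 1(1)] tA[OF 2(1)] 1(2) 2(2) ta]
        swap.smultA_addB[OF in_other_fibre[OF 1(1)] in_other_fibre[OF 2(1)] 1(1) 2(1), of t] 1(3) 2(3)
      by simp
    moreover have "r + r2 = t * pairing \<Phi> (d \<oplus>\<^bsub>VA\<^esub> d2) + pairing \<kappa> (c \<oplus>\<^bsub>VA\<^esub> c2)"
      using pairing_add[OF dual 1(1) 2(1)] kappa_add[OF \<kappa> 1(2) 2(2)] 1(4) 2(4)
      by (simp add: distrib_left)
    ultimately show "R (e \<oplus>\<^bsub>VA\<^esub> e2) (r + r2)"
      unfolding R_def using A.add_closed[OF 1(1) 2(1)] core_addA[OF 1(2) 2(2)] by blast
  next
    fix e r k assume "R e r"
    then obtain d c
      where 1: "d \<in> fibre VA a" "c \<in> core_fibre m"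
          "e = translate (t \<odot>\<^bsub>VB\<^esub> d) c" "r = t * pairing \<Phi> d + pairing \<kappa> c"
      unfolding R_def by blast
    have "k \<odot>\<^bsub>VA\<^esub> e = translate (t \<odot>\<^bsub>VB\<^esub> (k \<odot>\<^bsub>VA\<^esub> d)) (k \<odot>\<^bsub>VA\<^esub> c)"
      using translate_smultA[OF tA[OF 1(1)] 1(2) ta, of k] smult_commute[OF 1(1), of k t] 1(3) by simp
    moreover have "k * r = t * pairing \<Phi> (k \<odot>\<^bsub>VA\<^esub> d) + pairing \<kappa> (k \<odot>\<^bsub>VA\<^esub> c)"
      using pairing_smult[OF dual 1(1)] kappa_smult[OF \<kappa> 1(2)] 1(4) by (simp add: distrib_left)
    ultimately show "R (k \<odot>\<^bsub>VA\<^esub> e) (k * r)"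
      unfolding R_def using A.smult_closed[OF 1(1)] core_smultA[OF 1(2)] by blast
  qed
  then obtain \<Omega> where \<Omega>: "\<Omega> \<in> fibre (dual VA) (t \<odot>\<^bsub>WA\<^esub> a)"
      "\<And>e r. e \<in> fibre VA (t \<odot>\<^bsub>WA\<^esub> a) \<Longrightarrow> R e r \<Longrightarrow> pairing \<Omega> e = r"
    by blast
  have \<Omega>_eq: "pairing \<Omega> (translate (t \<odot>\<^bsub>VB\<^esub> d) c) = t * pairing \<Phi> d + pairing \<kappa> c"
    if "d \<in> fibre VA a" "c \<in> core_fibre m" for d c
    using \<Omega>(2)[OF translate_over_A[OF tA[OF that(1)] that(2) ta]] that unfolding R_def by blast
  have "pairing \<Omega> (t \<odot>\<^bsub>VB\<^esub> d) = t * pairing \<Phi> d" if "d \<in> fibre VA a" for d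
    using \<Omega>_eq[OF that core_zer[OF m(1)]] translate_zer[OF tA[OF that] ta] kappa_zer[OF \<kappa>] by simp
  moreover have "pairing \<Omega> (translate (zer VA (t \<odot>\<^bsub>WA\<^esub> a)) c) = pairing \<kappa> c" if c: "c \<in> core_fibre m" for c
    using \<Omega>_eq[OF zerA_closed[OF a] c] zerA_smult[OF a, of t]
      pairing_smult[OF dual zerA_closed[OF a], of 0] A.zero_smult[OF zerA_closed[OF a]] by simp
  then have "\<Omega> \<in> fibre P \<kappa>"
    using fibre_PI[OF \<Omega>(1) ta \<kappa>] by blast
  ultimately show ?thesis
    using fst_of_dual_fibre[OF \<Omega>(1)] unfolding a_def by blast
qed

lemma smult_P:
  assumes \<kappa>: "\<kappa> \<in> fibre (dual C) m" and \<Phi>: "\<Phi> \<in> fibre P \<kappa>"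
  shows "t \<odot>\<^bsub>P\<^esub> \<Phi> \<in> fibre P \<kappa>"
    and "fst (t \<odot>\<^bsub>P\<^esub> \<Phi>) = t \<odot>\<^bsub>WA\<^esub> fst \<Phi>"
    and "d \<in> fibre VA (fst \<Phi>) \<Longrightarrow> pairing (t \<odot>\<^bsub>P\<^esub> \<Phi>) (t \<odot>\<^bsub>VB\<^esub> d) = t * pairing \<Phi> d"
proof -
  let ?s = "t \<odot>\<^bsub>WA\<^esub> fst \<Phi>"
  define Q where "Q \<Omega> \<longleftrightarrow> \<Omega> \<in> fibre (dual VA) ?s \<and> core_prj VA VB WA C \<Omega> = core_prj VA VB WA C \<Phi> \<and>
    (\<forall>d\<in>fibre VA (fst \<Phi>). pairing \<Omega> (t \<odot>\<^bsub>VB\<^esub> d) = t * pairing \<Phi> d)" for \<Omega>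
  obtain \<Omega> where \<Omega>: "\<Omega> \<in> fibre P \<kappa>" "fst \<Omega> = ?s"
    "\<And>d. d \<in> fibre VA (fst \<Phi>) \<Longrightarrow> pairing \<Omega> (t \<odot>\<^bsub>VB\<^esub> d) = t * pairing \<Phi> d"
    using multiple_covector[OF assms] by blast
  have Q\<Omega>: "Q \<Omega>"
    unfolding Q_def using \<Omega> \<Phi>(1) fibre_P_iff by auto
  have "t \<odot>\<^bsub>P\<^esub> \<Phi> = (THE \<Omega>. Q \<Omega>)"
    by (simp add: dual_over_core_dual_def Q_def)
  also have "\<dots> = \<Omega>"
  proof (rule the_equality[of Q, OF Q\<Omega>])
    fix \<Omega>' assume Q': "Q \<Omega>'"
    then have \<Omega>': "\<Omega>' \<in> fibre P \<kappa>" and fst': "fst \<Omega>' = ?s"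
      using \<Phi> fibre_P_iff fst_of_dual_fibre[of \<Omega>' VA ?s] by (auto simp: Q_def)
    note a = fibre_PD(2)[OF \<Phi>]
    show "\<Omega>' = \<Omega>"
    proof (rule dual_eqI[of _ VA ?s])
      fix e assume e: "e \<in> fibre VA ?s"
      obtain d c where d: "d \<in> fibre VA (fst \<Phi>)" "d \<in> fibre VB (prj VB e)"
          "c \<in> core_fibre (fst \<kappa>)" "e = translate (t \<odot>\<^bsub>VB\<^esub> d) c"
        using decompose_multiple[OF a e] .
      have "t \<odot>\<^bsub>VB\<^esub> d \<in> fibre VA ?s"
        using swap.smultA_over_B[OF d(2,1)] .
      then show "pairing \<Omega>' e = pairing \<Omega> e"
        using Q' Q\<Omega> d pairing_translate[OF \<Omega>' d(3)] pairing_translate[OF \<Omega>(1) d(3)] fst' \<Omega>(2)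
        unfolding Q_def by simp
    qed (use Q' Q\<Omega> in \<open>auto simp: Q_def\<close>)
  qed
  finally have eq: "t \<odot>\<^bsub>P\<^esub> \<Phi> = \<Omega>" .
  show "t \<odot>\<^bsub>P\<^esub> \<Phi> \<in> fibre P \<kappa>" "fst (t \<odot>\<^bsub>P\<^esub> \<Phi>) = ?s"
    unfolding eq by fact+
  show "pairing (t \<odot>\<^bsub>P\<^esub> \<Phi>) (t \<odot>\<^bsub>VB\<^esub> d) = t * pairing \<Phi> d" if "d \<in> fibre VA (fst \<Phi>)"
    unfolding eq using \<Omega>(3) that .
qed

lemma bas_P: "bas P = tot (dual C)"
  by (simp add: dual_over_core_dual_def)

text \<open>
  The value of a sum of covectors is known on sums \<open>d +\<^sub>B d'\<close>, and the linearity of \<open>\<eta>\<close> says that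
  \<open>\<eta> (a + a')\<close> is such a sum.
\<close>

lemma sqcap_section_spec:
  assumes \<eta>: "bundle_morphism WA VB \<eta> Y" and over_a: "\<And>a. a \<in> tot WA \<Longrightarrow> \<eta> a \<in> fibre VA a"
    and \<kappa>: "\<kappa> \<in> fibre (dual C) m"
  shows "sqcap_section P \<eta> \<kappa> \<in> fibre (dual P) \<kappa>"
    and "\<Phi> \<in> fibre P \<kappa> \<Longrightarrow> pairing (sqcap_section P \<eta> \<kappa>) \<Phi> = pairing \<Phi> (\<eta> (fst \<Phi>))"
proof -
  note m = kappa_base[OF \<kappa>]
  have \<eta>A: "\<eta> a \<in> fibre VA a" and \<eta>B: "\<eta> a \<in> fibre VB (Y m)" if "a \<in> fibre WA m" for a
    using \<eta> m(1) that over_a by (auto simp: bundle_morphism_def fibre_def)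
  have \<eta>_add: "\<eta> (a \<oplus>\<^bsub>WA\<^esub> a') = \<eta> a \<oplus>\<^bsub>VB\<^esub> \<eta> a'" if "a \<in> fibre WA m" "a' \<in> fibre WA m" for a a'
    using \<eta> m(1) that by (simp add: bundle_morphism_def)
  have \<eta>_smult: "\<eta> (r \<odot>\<^bsub>WA\<^esub> a) = r \<odot>\<^bsub>VB\<^esub> \<eta> a" if "a \<in> fibre WA m" for r a
    using \<eta> m(1) that by (simp add: bundle_morphism_def)
  have base: "fst \<Phi> \<in> fibre WA m" if "\<Phi> \<in> fibre P \<kappa>" for \<Phi>
    using fibre_PD(2)[OF that] m(3) by simp
  have "\<exists>!\<Lambda>. \<Lambda> \<in> fibre (dual P) \<kappa> \<and> (\<forall>\<Phi>\<in>fibre P \<kappa>. pairing \<Lambda> \<Phi> = pairing \<Phi> (\<eta> (fst \<Phi>)))"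
  proof (rule dual_ex1)
    show "\<kappa> \<in> bas P"
      using \<kappa> by (simp add: bas_P fibre_def)
  next
    fix \<Phi> \<Phi>' assume \<Phi>: "\<Phi> \<in> fibre P \<kappa>" and \<Phi>': "\<Phi>' \<in> fibre P \<kappa>"
    show "\<Phi> \<oplus>\<^bsub>P\<^esub> \<Phi>' \<in> fibre P \<kappa> \<and> pairing (\<Phi> \<oplus>\<^bsub>P\<^esub> \<Phi>') (\<eta> (fst (\<Phi> \<oplus>\<^bsub>P\<^esub> \<Phi>'))) =
        pairing \<Phi> (\<eta> (fst \<Phi>)) + pairing \<Phi>' (\<eta> (fst \<Phi>'))"
      using add_P(1,2)[OF \<kappa> \<Phi> \<Phi>'] \<eta>_add[OF base[OF \<Phi>] base[OF \<Phi>']]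
        add_P(3)[OF \<kappa> \<Phi> \<Phi>' \<eta>A[OF base[OF \<Phi>]] \<eta>A[OF base[OF \<Phi>']] \<eta>B[OF base[OF \<Phi>]] \<eta>B[OF base[OF \<Phi>']]]
      by simp
  next
    fix r \<Phi> assume \<Phi>: "\<Phi> \<in> fibre P \<kappa>"
    show "r \<odot>\<^bsub>P\<^esub> \<Phi> \<in> fibre P \<kappa> \<and> pairing (r \<odot>\<^bsub>P\<^esub> \<Phi>) (\<eta> (fst (r \<odot>\<^bsub>P\<^esub> \<Phi>))) = r * pairing \<Phi> (\<eta> (fst \<Phi>))"
      using smult_P(1,2)[OF \<kappa> \<Phi>] \<eta>_smult[OF base[OF \<Phi>]] smult_P(3)[OF \<kappa> \<Phi> \<eta>A[OF base[OF \<Phi>]]] by simp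
  qed
  from theI'[OF this]
  show "sqcap_section P \<eta> \<kappa> \<in> fibre (dual P) \<kappa>"
    and "\<Phi> \<in> fibre P \<kappa> \<Longrightarrow> pairing (sqcap_section P \<eta> \<kappa>) \<Phi> = pairing \<Phi> (\<eta> (fst \<Phi>))"
    unfolding sqcap_section_def by blast+
qed

text \<open>
  Needed for a preimage under \<open>Z_A\<close>, of which nothing is known at first but that it is a covector.
\<close>

lemma core_prj_closed:
  assumes "\<Phi> \<in> tot (dual VA)"
  shows "core_prj VA VB WA C \<Phi> \<in> tot (dual C)"
proof -
  define a m where "a = fst \<Phi>" and "m = prj WA a"
  have \<Phi>: "\<Phi> \<in> fibre (dual VA) a"
    using assms dual_fibre_of_tot unfolding a_def by blast
  have a: "a \<in> fibre WA m"
    using base_of_dual_fibre[OF \<Phi>] bas_A by (simp add: m_def fibre_def)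
  note m = WA.base_of_fibre[OF a] and z = zerA_closed[OF a]
  have val: "pairing \<Phi> (zer VA a \<oplus>\<^bsub>VB\<^esub> c) = pairing \<Phi> (translate (zer VA a) c)" if "c \<in> core_fibre m" for c
    using zer_addB_core[OF that a] by simp
  have add: "pairing \<Phi> (zer VA a \<oplus>\<^bsub>VB\<^esub> (c \<oplus>\<^bsub>C\<^esub> c')) =
      pairing \<Phi> (zer VA a \<oplus>\<^bsub>VB\<^esub> c) + pairing \<Phi> (zer VA a \<oplus>\<^bsub>VB\<^esub> c')"
    if c: "c \<in> core_fibre m" "c' \<in> core_fibre m" for c c'
    using translate_addA[OF z z c a] A.add_zer[OF z] val[OF core_addA[OF c]] val[OF c(1)] val[OF c(2)]
      pairing_add[OF \<Phi> translate_over_A[OF z c(1) a] translate_over_A[OF z c(2) a]] core_add[OF c]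
    by simp
  have smult: "pairing \<Phi> (zer VA a \<oplus>\<^bsub>VB\<^esub> r \<odot>\<^bsub>C\<^esub> c) = r * pairing \<Phi> (zer VA a \<oplus>\<^bsub>VB\<^esub> c)"
    if c: "c \<in> core_fibre m" for r c
    using translate_smultA[OF z c a, of r] A.smult_zer[OF A.base_of_fibre[OF z]]
      val[OF core_smultA[OF c]] val[OF c] pairing_smult[OF \<Phi> translate_over_A[OF z c a], of r] core_smult[OF c]
    by simp
  have "c \<oplus>\<^bsub>C\<^esub> c' \<in> core_fibre m" "r \<odot>\<^bsub>C\<^esub> c \<in> core_fibre m"
    if "c \<in> core_fibre m" "c' \<in> core_fibre m" for c c' r
    using core_add core_smult core_addA core_smultA that by simp_all
  then have "(m, \<lambda>c\<in>core_fibre m. pairing \<Phi> (zer VA a \<oplus>\<^bsub>VB\<^esub> c)) \<in> tot (dual C)"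
    using add smult m core_bas fibre_core[OF m] by (simp add: dual_def)
  then show ?thesis
    using fibre_core[OF m] by (simp add: core_prj_def Let_def a_def m_def)
qed

end

context double_family_with_core
begin

text \<open>
  Translating \<open>d\<close> by \<open>c\<close> changes both values by \<open>\<kappa> c\<close>.
\<close>

lemma pairing_difference:
  assumes "\<Phi> \<in> fibre P \<kappa>" "\<Psi> \<in> fibre (dual_over_core_dual VB VA WB C) \<kappa>"
    and d: "d \<in> fibre VA (fst \<Phi>)" "d \<in> fibre VB (fst \<Psi>)"
    and e: "e \<in> fibre VA (fst \<Phi>)" "e \<in> fibre VB (fst \<Psi>)"
  shows "pairing \<Phi> e - pairing \<Psi> e = pairing \<Phi> d - pairing \<Psi> d"
proof -
  note a = fibre_PD(2)[OF assms(1)]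
  obtain c where c: "c \<in> core_fibre (fst \<kappa>)" "e = translate d c"
    using translate_transitive[OF d(1) e(1) d(2) e(2) a] .
  have "pairing \<Phi> e = pairing \<Phi> d + pairing \<kappa> c"
    unfolding c(2) using pairing_translate[OF assms(1) c(1) d(1)] .
  moreover have "pairing \<Psi> e = pairing \<Psi> d + pairing \<kappa> c"
    unfolding c(2) translate_swap[OF d c(1) a, symmetric]
    using swap.pairing_translate[OF assms(2) _ d(2)] c(1) by (simp add: core_fibre_swap)
  ultimately show ?thesis
    by simp
qed

lemma negative_linear_section:
  assumes "bundle_morphism WB VA \<zeta> Z"
  shows "bundle_morphism WB VA (\<lambda>b. (-1) \<odot>\<^bsub>VB\<^esub> \<zeta> b) (\<lambda>m. (-1) \<odot>\<^bsub>WA\<^esub> Z m)"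
proof -
  have "bundle_morphism VA VA (smult VB (-1)) (smult WA (-1))"
    using linear_A by (simp add: structure_maps_linear_def)
  then show ?thesis
    using morphism_comp[OF assms] by blast
qed

end

section \<open>Double vector bundles\<close>

text \<open>
  In a local trivialization the curve is \<open>r \<mapsto> (x, r *\<^sub>R t v)\<close>.
\<close>

lemma continuous_scaling:
  fixes E :: "('t, 'e::euclidean_space) manifold" and X :: "('x, 'f::euclidean_space) manifold"
  assumes "vector_bundle E X V" "v \<in> tot V"
  shows "continuous_map euclideanreal (space_of E) (\<lambda>r. r \<odot>\<^bsub>V\<^esub> v)"
proof -
  interpret fibrewise_vector_space V
    using assms(1) by unfold_locales (simp add: vector_bundle_def)
  define x where "x = prj V v"
  have v: "v \<in> fibre V x" and x: "x \<in> bas V"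
    using assms(2) base_of_fibre[of v x] by (auto simp: x_def fibre_def)
  obtain F :: "'e set" where F: "subspace F" and trivial: "\<forall>x\<in>bas V. \<exists>U t. openin (space_of X) U \<and> x \<in> U \<and>
      diffeomorphism (open_submanifold E {v \<in> tot V. prj V v \<in> U})
        (product_manifold (open_submanifold X U) (subspace_manifold F)) (\<lambda>v. (prj V v, t v)) \<and>
      (\<forall>y\<in>U. \<forall>v\<in>fibre V y. \<forall>w\<in>fibre V y. t (v \<oplus>\<^bsub>V\<^esub> w) = t v + t w) \<and>
      (\<forall>y\<in>U. \<forall>v\<in>fibre V y. \<forall>r. t (r \<odot>\<^bsub>V\<^esub> v) = r *\<^sub>R t v)"
    using assms(1) unfolding vector_bundle_def by (elim conjE exE)
  obtain U t where U: "openin (space_of X) U" "x \<in> U"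
    and diffeo: "diffeomorphism (open_submanifold E {v \<in> tot V. prj V v \<in> U})
            (product_manifold (open_submanifold X U) (subspace_manifold F)) (\<lambda>v. (prj V v, t v))"
    and t: "\<forall>y\<in>U. \<forall>v\<in>fibre V y. \<forall>r. t (r \<odot>\<^bsub>V\<^esub> v) = r *\<^sub>R t v"
    using bspec[OF trivial x] by (elim conjE exE)
  define S where "S = {v \<in> tot V. prj V v \<in> U}"
  define g where "g = (\<lambda>v. (prj V v, t v))"
  define T where "T = prod_topology (subtopology (space_of X) U) (top_of_set F)"
  have tE: "topspace (space_of E) = tot V"
    using assms(1) by (simp add: vector_bundle_def)
  then have S: "topspace (subtopology (space_of E) S) = S"
    by (auto simp: S_def)
  have bij: "bij_betw g S (topspace T)"
    and inv: "continuous_map T (subtopology (space_of E) S) (inv_into S g)"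
    using diffeo S unfolding diffeomorphism_def smooth_map_def
    by (auto simp: open_submanifold_def product_manifold_def subspace_manifold_def S_def g_def T_def)
  have rv: "r \<odot>\<^bsub>V\<^esub> v \<in> S" "g (r \<odot>\<^bsub>V\<^esub> v) = (x, r *\<^sub>R t v)" for r
    using smult_closed[OF v, of r] U(2) t v by (auto simp: S_def g_def fibre_def)
  have "g v \<in> topspace T"
    using bij_betwE[OF bij] rv(1)[of 1] smult_one[OF v] by auto
  then have tv: "t v \<in> F" and xU: "x \<in> topspace (subtopology (space_of X) U)"
    using v by (auto simp: T_def g_def fibre_def)
  have "continuous_map euclideanreal T (\<lambda>r. (x, r *\<^sub>R t v))"
    unfolding T_def
  proof (rule continuous_map_pairedI)
    show "continuous_map euclideanreal (subtopology (space_of X) U) (\<lambda>r. x)"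
      using xU by simp
    show "continuous_map euclideanreal (top_of_set F) (\<lambda>r. r *\<^sub>R t v)"
      using subspace_scale[OF F tv]
      by (auto simp: continuous_map_in_subtopology intro!: continuous_intros)
  qed
  from continuous_map_compose[OF this inv]
  have "continuous_map euclideanreal (subtopology (space_of E) S) (\<lambda>r. inv_into S g (x, r *\<^sub>R t v))"
    by (simp add: o_def)
  moreover have "inv_into S g (x, r *\<^sub>R t v) = r \<odot>\<^bsub>V\<^esub> v" for r
    using inv_into_f_f[OF bij_betw_imp_inj_on[OF bij] rv(1)[of r]] rv(2)[of r] by simp
  ultimately show ?thesis
    by (simp add: continuous_map_in_subtopology)
qed

lemma double_family_of_dvb:
  assumes "double_vector_bundle D"
  shows "double_family (DA D) (DB D) (AM D) (BM D)"
proof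
  note D = assms[unfolded double_vector_bundle_def vector_bundle_def]
  show "vector_space_family (DA D)" "vector_space_family (DB D)"
    "vector_space_family (AM D)" "vector_space_family (BM D)"
    "structure_maps_linear (DA D) (DB D) (AM D) (BM D)"
    "structure_maps_linear (DB D) (DA D) (BM D) (AM D)"
    using D by blast+
  show "tot (DA D) = tot (DB D)" "bas (DA D) = tot (AM D)" "bas (DB D) = tot (BM D)" "bas (AM D) = bas (BM D)"
    using D by metis+
  show "prj (AM D) (prj (DA D) d) = prj (BM D) (prj (DB D) d)" if "d \<in> tot (DA D)" for d
    using D that by blast
  show "\<exists>d. d \<in> fibre (DA D) a \<and> d \<in> fibre (DB D) b" if "a \<in> fibre (AM D) m" "b \<in> fibre (BM D) m" for m a b
  proof -
    have "surjective_submersion D"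
      using D by blast
    then have "\<forall>a\<in>tot (AM D). \<forall>b\<in>tot (BM D). prj (AM D) a = prj (BM D) b \<longrightarrow>
        (\<exists>d\<in>tot (DA D). prj (DA D) d = a \<and> prj (DB D) d = b)"
      unfolding surjective_submersion_def by (rule conjunct1)
    moreover have "a \<in> tot (AM D)" "b \<in> tot (BM D)" "prj (AM D) a = prj (BM D) b"
      using that by (simp_all add: fibre_def)
    ultimately obtain d where "d \<in> tot (DA D)" "prj (DA D) d = a" "prj (DB D) d = b"
      by blast
    moreover have "tot (DA D) = tot (DB D)"
      using D by metis
    ultimately show ?thesis
      by (auto simp: fibre_def)
  qed
qed

lemma double_family_with_core_of_dvb:
  assumes "double_vector_bundle D"
  shows "double_family_with_core (DA D) (DB D) (AM D) (BM D) (core D)"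
proof -
  interpret double_family "DA D" "DB D" "AM D" "BM D"
    using double_family_of_dvb[OF assms] .
  have bundles: "vector_bundle (manD D) (manA D) (DA D)" "vector_bundle (manD D) (manB D) (DB D)"
    using assms by (simp_all add: double_vector_bundle_def)
  have Hausdorff: "Hausdorff_space (space_of (manD D))"
    using bundles(1) by (simp add: vector_bundle_def smooth_manifold_def)
  show ?thesis
  proof
    show "bas (core D) = bas (AM D)"
      by (simp add: core_def)
    show "fibre (core D) m = core_fibre m" if "m \<in> bas (AM D)" for m
    proof -
      have "prj (AM D) (zer (AM D) m') = m'" if "m' \<in> bas (AM D)" for m'
        using WA.zer_closed[OF that] by (simp add: fibre_def)
      then show ?thesis
        using that tot_eq by (auto simp: core_fibre_def core_def fibre_def)
    qed
    show "r \<odot>\<^bsub>DA D\<^esub> c = r \<odot>\<^bsub>DB D\<^esub> c" if c: "c \<in> core_fibre m" for m c r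
    \<comment> \<open>Both sides are continuous in \<open>r\<close>, agree on the dense set of rationals, and \<open>D\<close> is Hausdorff.\<close>
    proof (rule forall_in_closure_of_eq[where S = \<rat> and X = euclideanreal])
      show "r \<in> euclideanreal closure_of \<rat>"
        by (simp add: Rats_closure_real)
      show "q \<odot>\<^bsub>DA D\<^esub> c = q \<odot>\<^bsub>DB D\<^esub> c" if "q \<in> \<rat>" for q
        using core_rat_smult_eq[OF c that] .
      have "c \<in> tot (DA D)" "c \<in> tot (DB D)"
        using core_fibreD[OF c] by (simp_all add: fibre_def)
      then show "continuous_map euclideanreal (space_of (manD D)) (\<lambda>r. r \<odot>\<^bsub>DA D\<^esub> c)"
        "continuous_map euclideanreal (space_of (manD D)) (\<lambda>r. r \<odot>\<^bsub>DB D\<^esub> c)"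
        using continuous_scaling[OF bundles(1)] continuous_scaling[OF bundles(2)] by simp_all
    qed (rule Hausdorff)
  qed (simp_all add: core_def)
qed

lemma dual_pairing_eq:
  assumes D: "double_vector_bundle D"
    and \<Phi>: "\<Phi> \<in> fibre (dual_A D) \<kappa>" and \<Psi>: "\<Psi> \<in> fibre (dual_B D) \<kappa>"
    and d: "d \<in> fibre (DA D) (fst \<Phi>)" "d \<in> fibre (DB D) (fst \<Psi>)"
  shows "dual_pairing D \<Phi> \<Psi> = pairing \<Phi> d - pairing \<Psi> d"
  unfolding dual_pairing_def
proof (rule the_equality)
  interpret double_family_with_core "DA D" "DB D" "AM D" "BM D" "core D"
    using double_family_with_core_of_dvb[OF D] .
  show "\<forall>e\<in>tot (DA D). prj (DA D) e = fst \<Phi> \<and> prj (DB D) e = fst \<Psi> \<longrightarrow>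
      pairing \<Phi> d - pairing \<Psi> d = pairing \<Phi> e - pairing \<Psi> e"
    using pairing_difference[OF \<Phi>[unfolded dual_A_def] \<Psi>[unfolded dual_B_def] _ _ d] tot_eq
    by (simp add: fibre_def)
next
  fix r assume "\<forall>e\<in>tot (DA D). prj (DA D) e = fst \<Phi> \<and> prj (DB D) e = fst \<Psi> \<longrightarrow>
      r = pairing \<Phi> e - pairing \<Psi> e"
  then show "r = pairing \<Phi> d - pairing \<Psi> d"
    using d by (simp add: fibre_def)
qed

text \<open>
  For covectors over \<open>b\<close> and \<open>b'\<close>, choose \<open>d\<close> and \<open>d'\<close> over \<open>(a, b)\<close> and \<open>(a, b')\<close>. The pairing with the sum can
  be evaluated at \<open>d +\<^sub>A d'\<close>, where both of its terms are additive.
\<close>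

lemma Z_A_spec:
  assumes D: "double_vector_bundle D" and \<kappa>: "\<kappa> \<in> tot (dual (core D))"
    and \<Phi>: "\<Phi> \<in> fibre (dual_A D) \<kappa>"
  shows "Z_A D \<Phi> \<in> fibre (dual (dual_B D)) \<kappa>"
    and "\<Psi> \<in> fibre (dual_B D) \<kappa> \<Longrightarrow> pairing (Z_A D \<Phi>) \<Psi> = dual_pairing D \<Phi> \<Psi>"
proof -
  interpret double_family_with_core "DA D" "DB D" "AM D" "BM D" "core D"
    using double_family_with_core_of_dvb[OF D] .
  define m where "m = fst \<kappa>"
  have \<kappa>m: "\<kappa> \<in> fibre (dual (core D)) m"
    using \<kappa> dual_fibre_of_tot unfolding m_def by blast
  note eq = dual_pairing_eq[OF D \<Phi>]
  have a: "fst \<Phi> \<in> fibre (AM D) m"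
    using fibre_PD(2)[OF \<Phi>[unfolded dual_A_def]] by (simp add: m_def)
  have b: "fst \<Psi> \<in> fibre (BM D) m" if "\<Psi> \<in> fibre (dual_B D) \<kappa>" for \<Psi>
    using swap.fibre_PD(2)[OF that[unfolded dual_B_def]] by (simp add: m_def)
  have "\<exists>!\<Lambda>. \<Lambda> \<in> fibre (dual (dual_B D)) \<kappa> \<and> (\<forall>\<Psi>\<in>fibre (dual_B D) \<kappa>. pairing \<Lambda> \<Psi> = dual_pairing D \<Phi> \<Psi>)"
  proof (rule dual_ex1)
    show "\<kappa> \<in> bas (dual_B D)"
      using \<kappa> by (simp add: dual_B_def dual_over_core_dual_def)
  next
    fix \<Psi> \<Psi>' assume \<Psi>: "\<Psi> \<in> fibre (dual_B D) \<kappa>" and \<Psi>': "\<Psi>' \<in> fibre (dual_B D) \<kappa>"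
    note sum = swap.add_P[OF \<kappa>m \<Psi>[unfolded dual_B_def] \<Psi>'[unfolded dual_B_def], folded dual_B_def]
    obtain d d' where d: "d \<in> fibre (DA D) (fst \<Phi>)" "d \<in> fibre (DB D) (fst \<Psi>)"
      and d': "d' \<in> fibre (DA D) (fst \<Phi>)" "d' \<in> fibre (DB D) (fst \<Psi>')"
      using surj[OF a b[OF \<Psi>]] surj[OF a b[OF \<Psi>']] by blast
    have "dual_pairing D \<Phi> (\<Psi> \<oplus>\<^bsub>dual_B D\<^esub> \<Psi>') =
        pairing \<Phi> (d \<oplus>\<^bsub>DA D\<^esub> d') - pairing (\<Psi> \<oplus>\<^bsub>dual_B D\<^esub> \<Psi>') (d \<oplus>\<^bsub>DA D\<^esub> d')"
      using eq[OF sum(1) A.add_closed[OF d(1) d'(1)]] addA_over_B[OF d(1) d'(1) d(2) d'(2)] sum(2) by simp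
    also have "\<dots> = dual_pairing D \<Phi> \<Psi> + dual_pairing D \<Phi> \<Psi>'"
      using sum(3)[OF d(2) d'(2) d(1) d'(1)] eq[OF \<Psi> d] eq[OF \<Psi>' d']
        pairing_add[OF fibre_PD(1)[OF \<Phi>[unfolded dual_A_def]] d(1) d'(1)] by simp
    finally show "\<Psi> \<oplus>\<^bsub>dual_B D\<^esub> \<Psi>' \<in> fibre (dual_B D) \<kappa> \<and>
        dual_pairing D \<Phi> (\<Psi> \<oplus>\<^bsub>dual_B D\<^esub> \<Psi>') = dual_pairing D \<Phi> \<Psi> + dual_pairing D \<Phi> \<Psi>'"
      using sum(1) by simp
  next
    fix r \<Psi> assume \<Psi>: "\<Psi> \<in> fibre (dual_B D) \<kappa>"
    note mult = swap.smult_P[OF \<kappa>m \<Psi>[unfolded dual_B_def], where t = r, folded dual_B_def]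
    obtain d where d: "d \<in> fibre (DA D) (fst \<Phi>)" "d \<in> fibre (DB D) (fst \<Psi>)"
      using surj[OF a b[OF \<Psi>]] by blast
    have "dual_pairing D \<Phi> (r \<odot>\<^bsub>dual_B D\<^esub> \<Psi>) =
        pairing \<Phi> (r \<odot>\<^bsub>DA D\<^esub> d) - pairing (r \<odot>\<^bsub>dual_B D\<^esub> \<Psi>) (r \<odot>\<^bsub>DA D\<^esub> d)"
      using eq[OF mult(1) A.smult_closed[OF d(1)]] smultA_over_B[OF d] mult(2) by simp
    also have "\<dots> = r * dual_pairing D \<Phi> \<Psi>"
      using mult(3)[OF d(2)] eq[OF \<Psi> d]
        pairing_smult[OF fibre_PD(1)[OF \<Phi>[unfolded dual_A_def]] d(1)] by (simp add: right_diff_distrib)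
    finally show "r \<odot>\<^bsub>dual_B D\<^esub> \<Psi> \<in> fibre (dual_B D) \<kappa> \<and>
        dual_pairing D \<Phi> (r \<odot>\<^bsub>dual_B D\<^esub> \<Psi>) = r * dual_pairing D \<Phi> \<Psi>"
      using mult(1) by simp
  qed
  moreover have "prj (dual_A D) \<Phi> = \<kappa>"
    using \<Phi> by (simp add: fibre_def)
  ultimately show "Z_A D \<Phi> \<in> fibre (dual (dual_B D)) \<kappa>"
    and "\<Psi> \<in> fibre (dual_B D) \<kappa> \<Longrightarrow> pairing (Z_A D \<Phi>) \<Psi> = dual_pairing D \<Phi> \<Psi>"
    unfolding Z_A_def using theI'[of "\<lambda>\<Lambda>. \<Lambda> \<in> fibre (dual (dual_B D)) \<kappa> \<and>
      (\<forall>\<Psi>\<in>fibre (dual_B D) \<kappa>. pairing \<Lambda> \<Psi> = dual_pairing D \<Phi> \<Psi>)"] by simp_all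
qed

lemma linear_section_over_B_fibres:
  assumes D: "double_vector_bundle D" and \<xi>: "linear_section_over_B D \<xi> X"
  shows "bundle_morphism (BM D) (DA D) \<xi> X"
    and "b \<in> tot (BM D) \<Longrightarrow> \<xi> b \<in> fibre (DB D) b"
    and "m \<in> bas (AM D) \<Longrightarrow> X m \<in> fibre (AM D) m"
proof -
  interpret double_family "DA D" "DB D" "AM D" "BM D"
    using double_family_of_dvb[OF D] .
  show morphism: "bundle_morphism (BM D) (DA D) \<xi> X"
    using \<xi> by (simp add: linear_section_over_B_def)
  show "\<xi> b \<in> fibre (DB D) b" if "b \<in> tot (BM D)"
  proof -
    have "\<xi> b \<in> fibre (DA D) (X (prj (BM D) b))"
      using morphism that WB.base_of_fibre[of b] by (simp add: bundle_morphism_def fibre_def)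
    moreover have "prj (DB D) (\<xi> b) = b"
      using \<xi> that bas_B by (simp add: linear_section_over_B_def smooth_section_def)
    ultimately show ?thesis
      using tot_eq by (simp add: fibre_def)
  qed
  show "X m \<in> fibre (AM D) m" if "m \<in> bas (AM D)"
    using \<xi> that bas_A bas_eq morphism
    by (simp add: linear_section_over_B_def smooth_section_def fibre_def bundle_morphism_def)
qed

lemma linear_section_over_A_fibres:
  assumes D: "double_vector_bundle D" and \<eta>: "linear_section_over_A D \<eta> Y"
  shows "bundle_morphism (AM D) (DB D) \<eta> Y"
    and "a \<in> tot (AM D) \<Longrightarrow> \<eta> a \<in> fibre (DA D) a"
    and "m \<in> bas (BM D) \<Longrightarrow> Y m \<in> fibre (BM D) m"
proof -
  interpret double_family "DA D" "DB D" "AM D" "BM D"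
    using double_family_of_dvb[OF D] .
  show morphism: "bundle_morphism (AM D) (DB D) \<eta> Y"
    using \<eta> by (simp add: linear_section_over_A_def)
  show "\<eta> a \<in> fibre (DA D) a" if "a \<in> tot (AM D)"
  proof -
    have "\<eta> a \<in> fibre (DB D) (Y (prj (AM D) a))"
      using morphism that WA.base_of_fibre[of a] by (simp add: bundle_morphism_def fibre_def)
    moreover have "prj (DA D) (\<eta> a) = a"
      using \<eta> that bas_A by (simp add: linear_section_over_A_def smooth_section_def)
    ultimately show ?thesis
      using tot_eq by (simp add: fibre_def)
  qed
  show "Y m \<in> fibre (BM D) m" if "m \<in> bas (BM D)"
    using \<eta> that bas_B bas_eq morphism
    by (simp add: linear_section_over_A_def smooth_section_def fibre_def bundle_morphism_def)
qed

text \<open>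
  By the definition of translation, the two equations for the warp are the two ways of writing one
  equation.
\<close>

lemma warp_translate:
  assumes D: "double_vector_bundle D" and grid: "grid D \<xi> X \<eta> Y" and m: "m \<in> bas (AM D)"
  shows "warp D \<xi> X \<eta> Y m \<in> double_family.core_fibre (DA D) (DB D) (AM D) (BM D) m"
    and "\<xi> (Y m) = double_family.translate (DA D) (DB D) (\<eta> (X m)) (warp D \<xi> X \<eta> Y m)"
proof -
  interpret double_family_with_core "DA D" "DB D" "AM D" "BM D" "core D"
    using double_family_with_core_of_dvb[OF D] .
  note \<xi> = linear_section_over_B_fibres[OF D grid[unfolded grid_def, THEN conjunct1]]
  note \<eta> = linear_section_over_A_fibres[OF D grid[unfolded grid_def, THEN conjunct2]]
  have X: "X m \<in> fibre (AM D) m" and Y: "Y m \<in> fibre (BM D) m"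
    using \<xi>(3) \<eta>(3) m bas_eq by auto
  have \<xi>Y: "\<xi> (Y m) \<in> fibre (DA D) (X m)" "\<xi> (Y m) \<in> fibre (DB D) (Y m)"
    using \<xi>(1,2) Y m bas_eq by (simp_all add: bundle_morphism_def fibre_def)
  have \<eta>X: "\<eta> (X m) \<in> fibre (DA D) (X m)" "\<eta> (X m) \<in> fibre (DB D) (Y m)"
    using \<eta>(1,2) X m by (simp_all add: bundle_morphism_def fibre_def)
  obtain c where c: "c \<in> core_fibre m" "\<xi> (Y m) = translate (\<eta> (X m)) c"
    using translate_transitive[OF \<eta>X(1) \<xi>Y(1) \<eta>X(2) \<xi>Y(2) X] .
  have swapped_core_fibre: "c \<in> swap.core_fibre m"
    using c(1) by (simp add: core_fibre_swap)
  have "warp D \<xi> X \<eta> Y m = c"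
    unfolding warp_def
  proof (rule the_equality, intro conjI)
    show "c \<in> fibre (core D) m"
      using c(1) fibre_core[OF m] by simp
    show "diff (DA D) (\<xi> (Y m)) (\<eta> (X m)) = c \<oplus>\<^bsub>DB D\<^esub> zer (DA D) (X m)"
      using A.diff_eq[OF \<eta>X(1) core_plus_zer(1)[OF c(1) X]] c(2) translate_A[OF \<eta>X(1) c(1) X] by simp
    show "diff (DB D) (\<xi> (Y m)) (\<eta> (X m)) = c \<oplus>\<^bsub>DA D\<^esub> zer (DB D) (Y m)"
      using B.diff_eq[OF \<eta>X(2) swap.core_plus_zer(1)[OF swapped_core_fibre Y]] c(2)
        translate_B[OF \<eta>X c(1) X] by simp
  next
    fix c' assume c': "c' \<in> fibre (core D) m \<and>
      diff (DA D) (\<xi> (Y m)) (\<eta> (X m)) = c' \<oplus>\<^bsub>DB D\<^esub> zer (DA D) (X m) \<and>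
      diff (DB D) (\<xi> (Y m)) (\<eta> (X m)) = c' \<oplus>\<^bsub>DA D\<^esub> zer (DB D) (Y m)"
    then have "c' \<in> core_fibre m" "\<xi> (Y m) = translate (\<eta> (X m)) c'"
      using fibre_core[OF m] A.add_diff[OF \<xi>Y(1) \<eta>X(1)] translate_A[OF \<eta>X(1) _ X] by auto
    then show "c' = c"
      using translate_free[OF \<eta>X(1) _ c(1) X] c(2) by simp
  qed
  then show "warp D \<xi> X \<eta> Y m \<in> core_fibre m" "\<xi> (Y m) = translate (\<eta> (X m)) (warp D \<xi> X \<eta> Y m)"
    using c by simp_all
qed

theorem proposition17:
  fixes D :: "('d, 'a, 'b, 'm, 'ed::euclidean_space, 'ea::euclidean_space,
                'eb::euclidean_space, 'em::euclidean_space) dvb"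
    and \<xi> :: "'b \<Rightarrow> 'd" and X :: "'m \<Rightarrow> 'a" and \<eta> :: "'a \<Rightarrow> 'd" and Y :: "'m \<Rightarrow> 'b"
  assumes "double_vector_bundle D"
    and "grid D \<xi> X \<eta> Y"
  shows "\<forall>\<kappa>\<in>tot (dual (core D)).
           section_bracket D (sqcap_section (dual_B D) \<xi>) (sqcap_section (dual_A D) \<eta>) \<kappa> =
           linear_function (warp D \<xi> X \<eta> Y) \<kappa>"
proof
  note D = assms(1)
  interpret double_family_with_core "DA D" "DB D" "AM D" "BM D" "core D"
    using double_family_with_core_of_dvb[OF D] .
  note \<xi> = linear_section_over_B_fibres[OF D assms(2)[unfolded grid_def, THEN conjunct1]]
  note \<eta> = linear_section_over_A_fibres[OF D assms(2)[unfolded grid_def, THEN conjunct2]]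
  fix \<kappa> assume \<kappa>: "\<kappa> \<in> tot (dual (core D))"
  define m where "m = fst \<kappa>"
  have \<kappa>m: "\<kappa> \<in> fibre (dual (core D)) m"
    using \<kappa> dual_fibre_of_tot unfolding m_def by blast
  note m = kappa_base[OF \<kappa>m]
  note X = \<xi>(3)[OF m(1)] and Y = \<eta>(3)[OF m(2)]
  define \<sigma> where "\<sigma> = sqcap_section (dual_B D) \<xi> \<kappa>"
  define \<tau> where "\<tau> = sqcap_section (dual_A D) \<eta> \<kappa>"
  have \<sigma>: "\<sigma> \<in> fibre (dual (dual_B D)) \<kappa>"
    "\<And>\<Psi>. \<Psi> \<in> fibre (dual_B D) \<kappa> \<Longrightarrow> pairing \<sigma> \<Psi> = pairing \<Psi> (\<xi> (fst \<Psi>))"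
    using swap.sqcap_section_spec[OF \<xi>(1,2) \<kappa>m] by (simp_all add: \<sigma>_def dual_B_def)
  have \<tau>: "pairing \<tau> \<Phi> = pairing \<Phi> (\<eta> (fst \<Phi>))" if "\<Phi> \<in> fibre (dual_A D) \<kappa>" for \<Phi>
    using sqcap_section_spec(2)[OF \<eta>(1,2) \<kappa>m] that by (simp add: \<tau>_def dual_A_def)

  \<comment> \<open>The sign is forced: \<open>\<Psi>\<close> may be changed by any covector pulled back from \<open>A\<close>, so a preimage lies over \<open>- X m\<close>.\<close>
  obtain \<Phi>0 where \<Phi>0: "\<Phi>0 \<in> fibre (dual_A D) \<kappa>" "fst \<Phi>0 = (-1) \<odot>\<^bsub>AM D\<^esub> X m"
      "\<And>b. b \<in> fibre (BM D) m \<Longrightarrow> pairing \<Phi>0 ((-1) \<odot>\<^bsub>DB D\<^esub> \<xi> b) = 0"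
    using vanishing_covector[OF negative_linear_section[OF \<xi>(1)] B.smult_closed[OF \<xi>(2)]
        WA.smult_closed[OF X] \<kappa>m]
    unfolding dual_A_def by blast
  have "Z_A D \<Phi>0 = \<sigma>"
  proof (rule dual_eqI[OF Z_A_spec(1)[OF D \<kappa> \<Phi>0(1)] \<sigma>(1)])
    fix \<Psi> assume \<Psi>: "\<Psi> \<in> fibre (dual_B D) \<kappa>"
    let ?b = "fst \<Psi>"
    note \<Psi>b = swap.fibre_PD[OF \<Psi>[unfolded dual_B_def]]
    have b: "?b \<in> fibre (BM D) m"
      using \<Psi>b(2) by (simp add: m_def)
    have \<xi>b: "\<xi> ?b \<in> fibre (DA D) (X m)" "\<xi> ?b \<in> fibre (DB D) ?b"
      using \<xi>(1,2) b m(2) by (simp_all add: bundle_morphism_def fibre_def)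
    have "dual_pairing D \<Phi>0 \<Psi> = pairing \<Phi>0 ((-1) \<odot>\<^bsub>DB D\<^esub> \<xi> ?b) - pairing \<Psi> ((-1) \<odot>\<^bsub>DB D\<^esub> \<xi> ?b)"
      using dual_pairing_eq[OF D \<Phi>0(1) \<Psi> _ B.smult_closed[OF \<xi>b(2)]]
        swap.smultA_over_B[OF \<xi>b(2,1)] \<Phi>0(2) by simp
    also have "\<dots> = pairing \<Psi> (\<xi> ?b)"
      using \<Phi>0(3)[OF b] pairing_smult[OF \<Psi>b(1) \<xi>b(2)] by simp
    finally show "pairing (Z_A D \<Phi>0) \<Psi> = pairing \<sigma> \<Psi>"
      using Z_A_spec(2)[OF D \<kappa> \<Phi>0(1) \<Psi>] \<sigma>(2)[OF \<Psi>] by simp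
  qed
  moreover have "\<Phi>0 \<in> tot (dual_A D)"
    using \<Phi>0(1) by (simp add: fibre_def)
  ultimately have \<sigma>_range: "\<sigma> \<in> Z_A D ` tot (dual_A D)"
    by blast
  define \<Phi> where "\<Phi> = inv_into (tot (dual_A D)) (Z_A D) \<sigma>"
  have \<Phi>t: "\<Phi> \<in> tot (dual_A D)" and Z\<Phi>: "Z_A D \<Phi> = \<sigma>"
    using inv_into_into[OF \<sigma>_range] f_inv_into_f[OF \<sigma>_range] by (simp_all add: \<Phi>_def)
  \<comment> \<open>That \<open>\<Phi>\<close> lies over \<open>\<kappa>\<close> has to be read off from the base point of its image.\<close>
  define \<kappa>' where "\<kappa>' = prj (dual_A D) \<Phi>"
  have \<Phi>': "\<Phi> \<in> fibre (dual_A D) \<kappa>'" and "\<kappa>' \<in> tot (dual (core D))"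
    using \<Phi>t core_prj_closed
    by (simp_all add: \<kappa>'_def fibre_def dual_A_def dual_over_core_dual_def)
  then have "\<sigma> \<in> fibre (dual (dual_B D)) \<kappa>'"
    using Z_A_spec(1)[OF D _ \<Phi>'] Z\<Phi> by simp
  then have \<Phi>: "\<Phi> \<in> fibre (dual_A D) \<kappa>"
    using \<Phi>' \<sigma>(1) by (simp add: fibre_def)
  \<comment> \<open>The test covector: it vanishes on \<open>\<eta>\<close>, so it sees only the warp in \<open>\<xi> (Y m)\<close>.\<close>
  obtain \<Psi>0 where \<Psi>0: "\<Psi>0 \<in> fibre (dual_B D) \<kappa>" "fst \<Psi>0 = Y m"
      "\<And>a. a \<in> fibre (AM D) m \<Longrightarrow> pairing \<Psi>0 (\<eta> a) = 0"
    using swap.vanishing_covector[OF \<eta>(1,2) Y \<kappa>m] unfolding dual_B_def by blast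
  have \<eta>A: "\<eta> a \<in> fibre (DA D) a" and \<eta>B: "\<eta> a \<in> fibre (DB D) (Y m)" if "a \<in> fibre (AM D) m" for a
    using \<eta>(1,2) that m(1) by (simp_all add: bundle_morphism_def fibre_def)
  note a = fibre_PD(2)[OF \<Phi>[unfolded dual_A_def], folded m_def]
  note w = warp_translate[OF D assms(2) m(1)]
  have "pairing \<Phi> (\<eta> (fst \<Phi>)) = dual_pairing D \<Phi> \<Psi>0"
    using dual_pairing_eq[OF D \<Phi> \<Psi>0(1) \<eta>A[OF a]] \<eta>B[OF a] \<Psi>0(2,3) a by simp
  also have "\<dots> = pairing \<Psi>0 (\<xi> (Y m))"
    using Z_A_spec(2)[OF D \<kappa> \<Phi> \<Psi>0(1)] Z\<Phi> \<sigma>(2)[OF \<Psi>0(1)] \<Psi>0(2) by simp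
  also have "\<dots> = pairing \<Psi>0 (\<eta> (X m)) + pairing \<kappa> (warp D \<xi> X \<eta> Y m)"
    unfolding w(2) translate_swap[OF \<eta>A[OF X] \<eta>B[OF X] w(1) X, symmetric]
    using swap.pairing_translate[OF \<Psi>0(1)[unfolded dual_B_def], folded m_def] w(1) \<eta>B[OF X] \<Psi>0(2)
    by (simp add: core_fibre_swap)
  finally have \<Phi>_\<eta>: "pairing \<Phi> (\<eta> (fst \<Phi>)) = pairing \<kappa> (warp D \<xi> X \<eta> Y m)"
    using \<Psi>0(3)[OF X] by simp
  show "section_bracket D (sqcap_section (dual_B D) \<xi>) (sqcap_section (dual_A D) \<eta>) \<kappa> =
           linear_function (warp D \<xi> X \<eta> Y) \<kappa>"
    unfolding section_bracket_def linear_function_def m(3)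
    using \<tau>[OF \<Phi>] \<Phi>_\<eta> \<Phi>_def by (simp add: \<sigma>_def \<tau>_def)
qed

end
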